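(* Let $0<\alpha\le2$, $q\ge1$, and let $G$ be a probability distribution on $\mathbb{R}$ in the normal domain of attraction of $\mathcal{S}_\alpha(\sigma,0)$ for some $\sigma>0$. The following convergences hold in the sense of finite-dimensional distributions as $\lambda\to\infty$. 1. Let $N_\lambda(ds,d\xi)$ be a Poisson random measure on $S^q\times\mathbb{R}$ with intensity $\lambda\,ds\,G(d\xi)$. The random process $B_\lambda$ on $S^q$ defined by $$B_\lambda(m)=\sqrt{\pi}\,\sigma^{-1}\lambda^{-1/\alpha}\int_{S^q\times\mathbb{R}}\xi\,\mathbf{1}_{H_O\Delta H_m}(s)\,N_\lambda(ds,d\xi),\quad m\in S^q,$$ converges weakly to the symmetric $\alpha$-stable Lévy motion on the sphere $S^q$. 2. Let $N_\lambda(ds,dr,d\xi)$ be a Poisson random measure on $S^{q-1}\times(0,\infty)\times\mathbb{R}$ with intensity $\lambda\,ds\,dr\,G(d\xi)$. The random process $B_\lambda$ on $\mathbb{R}^q$ defined by $$B_\lambda(m)=\sigma^{-1}\lambda^{-1/\alpha}\int_{S^{q-1}\times(0,\infty)\times\mathbb{R}}\xi\,\mathbf{1}_{V_m}(s,r)\,N_\lambda(ds,dr,d\xi),\quad m\in\mathbb{R}^q,$$ converges weakly to the symmetric $\alpha$-stable Lévy motion on the Euclidean space $\mathbb{R}^q$.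
   Context: $\mathcal{S}_\alpha(\sigma,0)$ is the law with characteristic function $\exp(-\sigma^\alpha|\theta|^\alpha)$. A distribution is in its normal domain of attraction if, for i.i.d. $Y_i$ with this distribution, $n^{-1/\alpha}\sum_{i=1}^nY_i$ converges in law to $\mathcal{S}_\alpha(\sigma,0)$ (no centering). $S^q$ is the unit sphere of $\mathbb{R}^{q+1}$ with geodesic distance $d$; $ds$ is the uniform measure on the sphere normalised to total mass $1$; $O\in S^q$ is a fixed point; $H_m=\{m'\in S^q: d(m,m')\le\pi/2\}$ is the hemisphere centered at $m$; $\Delta$ is symmetric difference. For $m\in\mathbb{R}^q$, $V_m=\{(s,r)\in S^{q-1}\times(0,\infty): 0<r<\langle s,m\rangle\}$. A symmetric $\alpha$-stable random measure $W_\alpha$ with control measure $\kappa$ on a space $E$ is a process $(W_\alpha[f])_{f\in L^\alpha(E,\kappa)}$, a.s. linear in $f$, with $W_\alpha[f]\sim\mathcal{S}_\alpha\left((\int|f|^\alpha d\kappa)^{1/\alpha},0\right)$; write $W_\alpha(A)=W_\alpha[\mathbf{1}_A]$. The symmetric $\alpha$-stable Lévy motion on $S^q$ is $B(m)=\sqrt{\pi}\,W_\alpha(H_O\Delta H_m)$, $m\in S^q$, with $W_\alpha$ having control measure $ds$ on $S^q$. The symmetric $\alpha$-stable Lévy(–Chentsov) motion on $\mathbb{R}^q$ is $B(m)=W_\alpha(V_m)$, $m\in\mathbb{R}^q$, with $W_\alpha$ having control measure $ds\,dr$ on $S^{q-1}\times(0,\infty)$. A Poisson random measure $N$ with $\sigma$-finite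 intensity $n$ is a random measure such that for pairwise disjoint sets $A_i$ of finite $n$-measure, the $N(A_i)$ are independent Poisson variables with means $n(A_i)$. *)

theory Defs
  imports "HOL-Probability.Probability"
begin

subsection \<open>Stable laws and weak convergence\<close>

text \<open>
  \<open>is_sas_law \<alpha> \<sigma> M\<close> says that \<open>M\<close> is the law \<open>S\<^sub>\<alpha>(\<sigma>, 0)\<close>; by uniqueness of
  characteristic functions there is at most one such \<open>M\<close>.  For \<open>\<sigma> = 0\<close> this is the
  point mass at \<open>0\<close>, as \<open>0 powr \<alpha> = 0\<close>.
\<close>
definition is_sas_law :: "real \<Rightarrow> real \<Rightarrow> real measure \<Rightarrow> bool" where
  "is_sas_law \<alpha> \<sigma> M \<longleftrightarrow> real_distribution M \<and>
     (\<forall>\<theta>. char M \<theta> = complex_of_real (exp (- (\<sigma> powr \<alpha>) * \<bar>\<theta>\<bar> powr \<alpha>)))"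

text \<open>
  The i.i.d. sequence \<open>Y\<^sub>i\<close> with distribution \<open>G\<close> is realised as the sequence of coordinates
  on the infinite product space.
\<close>
definition normal_domain_of_attraction :: "real \<Rightarrow> real \<Rightarrow> real measure \<Rightarrow> bool" where
  "normal_domain_of_attraction \<alpha> \<sigma> G \<longleftrightarrow> real_distribution G \<and>
     (\<exists>S. is_sas_law \<alpha> \<sigma> S \<and>
       weak_conv_m
         (\<lambda>n. distr (Pi\<^sub>M UNIV (\<lambda>_::nat. G)) borel
                (\<lambda>y. real n powr (- 1 / \<alpha>) * (\<Sum>i=1..n. y i))) S)"

definition weakly_converges ::
  "'a topology \<Rightarrow> ('b \<Rightarrow> 'a measure) \<Rightarrow> 'a measure \<Rightarrow> 'b filter \<Rightarrow> bool" where
  "weakly_converges X \<mu> \<nu> F \<longleftrightarrow>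
     (\<forall>\<phi>. continuous_map X euclideanreal \<phi> \<and> bounded (\<phi> ` topspace X) \<longrightarrow>
        ((\<lambda>i. \<integral>x. \<phi> x \<partial>\<mu> i) \<longlongrightarrow> (\<integral>x. \<phi> x \<partial>\<nu>)) F)"

text \<open>The law of the random vector \<open>(X\<^sub>j)\<^sub>j\<^sub>\<in>\<^sub>J\<close>, a measure on \<open>\<real>\<^sup>J\<close> (extensional functions on \<open>J\<close>).\<close>
definition fin_dim_law ::
  "'w measure \<Rightarrow> ('i \<Rightarrow> 'w \<Rightarrow> real) \<Rightarrow> 'i set \<Rightarrow> ('i \<Rightarrow> real) measure" where
  "fin_dim_law P X J = distr P (Pi\<^sub>M J (\<lambda>_. borel)) (\<lambda>\<omega>. \<lambda>j\<in>J. X j \<omega>)"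

definition fdd_converges ::
  "'i set \<Rightarrow> ('b \<Rightarrow> 'w measure) \<Rightarrow> ('b \<Rightarrow> 'i \<Rightarrow> 'w \<Rightarrow> real) \<Rightarrow>
   'v measure \<Rightarrow> ('i \<Rightarrow> 'v \<Rightarrow> real) \<Rightarrow> 'b filter \<Rightarrow> bool" where
  "fdd_converges T P X Q Y F \<longleftrightarrow>
     (\<forall>J. finite J \<and> J \<subseteq> T \<longrightarrow>
        weakly_converges (product_topology (\<lambda>_. euclideanreal) J)
          (\<lambda>l. fin_dim_law (P l) (X l) J) (fin_dim_law Q Y J) F)"


subsection \<open>Random measures\<close>

text \<open>
  The last two clauses say that the \<open>N(A\<^sub>i)\<close> are independent and Poisson with means \<open>n(A\<^sub>i)\<close>
  (the library's \<open>poisson_pmf\<close> excludes mean \<open>0\<close>).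
\<close>
definition poisson_random_measure ::
  "'w measure \<Rightarrow> 'e measure \<Rightarrow> ('w \<Rightarrow> 'e measure) \<Rightarrow> bool" where
  "poisson_random_measure P n N \<longleftrightarrow>
     prob_space P \<and> sigma_finite_measure n \<and>
     (\<forall>\<omega>\<in>space P. sets (N \<omega>) = sets n) \<and>
     (\<forall>A\<in>sets n. (\<lambda>\<omega>. emeasure (N \<omega>) A) \<in> borel_measurable P) \<and>
     (\<forall>(I::nat set) A.
        disjoint_family_on A I \<and> (\<forall>i\<in>I. A i \<in> sets n \<and> emeasure n (A i) < \<infinity>) \<longrightarrow>
        prob_space.indep_vars P (\<lambda>_. borel) (\<lambda>i \<omega>. emeasure (N \<omega>) (A i)) I \<and>
        (\<forall>i\<in>I. \<forall>k::nat.
           measure P {\<omega>\<in>space P. emeasure (N \<omega>) (A i) = of_nat k} =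
             exp (- measure n (A i)) * measure n (A i) ^ k / fact k))"

definition L_alpha :: "real \<Rightarrow> 'e measure \<Rightarrow> ('e \<Rightarrow> real) set" where
  "L_alpha \<alpha> \<kappa> = {f \<in> borel_measurable \<kappa>. integrable \<kappa> (\<lambda>x. \<bar>f x\<bar> powr \<alpha>)}"

text \<open>
  The process is indexed by functions rather than by their classes modulo \<open>\<kappa>\<close>-null sets; if
  \<open>f = g\<close> almost everywhere, then \<open>W f - W g = W (f - g)\<close> has law \<open>S\<^sub>\<alpha>(0, 0)\<close>, so
  \<open>W f = W g\<close> almost surely.
\<close>
definition stable_random_measure ::
  "real \<Rightarrow> 'v measure \<Rightarrow> 'e measure \<Rightarrow> (('e \<Rightarrow> real) \<Rightarrow> 'v \<Rightarrow> real) \<Rightarrow> bool" where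
  "stable_random_measure \<alpha> Q \<kappa> W \<longleftrightarrow>
     prob_space Q \<and>
     (\<forall>f\<in>L_alpha \<alpha> \<kappa>. W f \<in> borel_measurable Q \<and>
        is_sas_law \<alpha> ((\<integral>x. \<bar>f x\<bar> powr \<alpha> \<partial>\<kappa>) powr (1 / \<alpha>)) (distr Q borel (W f))) \<and>
     (\<forall>f\<in>L_alpha \<alpha> \<kappa>. \<forall>g\<in>L_alpha \<alpha> \<kappa>. \<forall>a b.
        AE \<omega> in Q. W (\<lambda>x. a * f x + b * g x) \<omega> = a * W f \<omega> + b * W g \<omega>)"


subsection \<open>Sphere and half-spaces\<close>

text \<open>
  The uniform probability measure \<open>ds\<close> on the unit sphere, obtained by projecting the uniform
  distribution of the unit ball radially (\<open>sgn x = x /\<^sub>R norm x\<close>).  In dimension one it gives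
  mass \<open>1/2\<close> to each of \<open>-1\<close> and \<open>1\<close>.
\<close>
definition sphere_measure :: "'a::euclidean_space measure" where
  "sphere_measure =
     restrict_space (distr (uniform_measure lborel (ball 0 1)) borel sgn) (sphere 0 1)"

text \<open>Great-circle distance; meaningful for points of the unit sphere.\<close>
definition geodesic_dist :: "'a::euclidean_space \<Rightarrow> 'a \<Rightarrow> real" where
  "geodesic_dist x y = arccos (x \<bullet> y)"

definition hemisphere :: "'a::euclidean_space \<Rightarrow> 'a set" where
  "hemisphere m = {m' \<in> sphere 0 1. geodesic_dist m m' \<le> pi / 2}"

definition hemisphere_diff :: "'a::euclidean_space \<Rightarrow> 'a \<Rightarrow> 'a set" where
  "hemisphere_diff p m = sym_diff (hemisphere p) (hemisphere m)"

text \<open>The measure \<open>ds dr\<close> on \<open>S\<^sup>q\<^sup>-\<^sup>1 \<times> (0, \<infinity>)\<close>.\<close>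
definition hyperplane_measure :: "('a::euclidean_space \<times> real) measure" where
  "hyperplane_measure = sphere_measure \<Otimes>\<^sub>M restrict_space lborel {0<..}"

definition V_set :: "'a::euclidean_space \<Rightarrow> ('a \<times> real) set" where
  "V_set m = {(s, r). s \<in> sphere 0 1 \<and> 0 < r \<and> r < s \<bullet> m}"

definition levy_motion_sphere ::
  "'a::euclidean_space \<Rightarrow> (('a \<Rightarrow> real) \<Rightarrow> 'v \<Rightarrow> real) \<Rightarrow> 'a \<Rightarrow> 'v \<Rightarrow> real" where
  "levy_motion_sphere p W m \<omega> = sqrt pi * W (indicator (hemisphere_diff p m)) \<omega>"

definition levy_motion_euclidean ::
  "(('a::euclidean_space \<times> real \<Rightarrow> real) \<Rightarrow> 'v \<Rightarrow> real) \<Rightarrow> 'a \<Rightarrow> 'v \<Rightarrow> real" where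
  "levy_motion_euclidean W m \<omega> = W (indicator (V_set m)) \<omega>"

lemma prob_space_sphere_measure: "prob_space (sphere_measure :: 'a::euclidean_space measure)"
proof -
  let ?U = "uniform_measure lborel (ball 0 1) :: 'a measure"
  let ?D = "distr ?U borel (sgn :: 'a \<Rightarrow> 'a)"
  have meas: "sgn \<in> ?U \<rightarrow>\<^sub>M (borel :: 'a measure)"
    unfolding sgn_div_norm[abs_def] by measurable
  have fin: "emeasure lborel (ball 0 1 :: 'a set) \<noteq> \<infinity>"
    using emeasure_lborel_ball_finite[of "0::'a" 1] by simp
  have pos: "emeasure lborel (ball 0 1 :: 'a set) \<noteq> 0"
    using content_ball_pos[of 1 "0::'a"] by (auto simp: measure_def)
  have U: "prob_space ?U"
    by (rule prob_space_uniform_measure[OF pos fin])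
  interpret D: prob_space ?D
    by (rule prob_space.prob_space_distr[OF U meas])
  have "AE x in lborel. x \<noteq> (0::'a)"
    by (rule AE_lborel_singleton)
  then have "AE x in ?U. x \<noteq> 0"
    by (intro AE_uniform_measureI) auto
  then have "AE x in ?U. sgn x \<in> (sphere 0 1 :: 'a set)"
    by eventually_elim (simp add: norm_sgn)
  then have "AE y in ?D. y \<in> sphere 0 1"
    by (subst AE_distr_iff[OF meas]) (auto simp: pred_def)
  then have "emeasure ?D (sphere 0 1) = 1"
    by (intro D.emeasure_eq_1_AE) auto
  then show ?thesis
    by (intro prob_spaceI) (simp add: sphere_measure_def emeasure_restrict_space space_restrict_space)
qed

end

theory Submission
  imports Defs
begin

text \<open>
  Both parts are instances of one statement about a \<open>\<sigma>\<close>-finite measure \<open>\<kappa>\<close> and sets \<open>A m\<close> of finite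
  \<open>\<kappa>\<close>-measure (\<open>poisson_sums_fdd_converge_to_stable\<close>): the sums of the marks \<open>\<xi>\<close> over the points of the
  Poisson measure that lie in \<open>A m\<close>, suitably normalised, converge to the stable measure of \<open>A m\<close>.
  The geometry enters only through the measurability and finite mass of the sets \<open>H\<^sub>O \<Delta> H\<^sub>m\<close> and \<open>V\<^sub>m\<close>.

  The proof compares characteristic functions. A linear combination, with weights \<open>\<theta> j\<close>, of the sums
  over the sets \<open>A j\<close> is the integral of \<open>\<xi> * f s\<close> against the Poisson measure, where
  \<open>f = (\<Sum>j. \<theta> j * indicator (A j))\<close> takes finitely many values. The exponential formula for Poisson
  integrals (\<open>prm_char_integral\<close>) and Fubini give its characteristic function
  \<open>exp (l * \<integral> (\<phi> (b l * f s) - 1) \<partial>\<kappa>)\<close>, where \<open>\<phi>\<close> is the characteristic function of \<open>G\<close> and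
  \<open>b l = l powr (-1/\<alpha>) / \<sigma>\<close>. The stable side has \<open>exp (- \<integral> \<bar>f\<bar> powr \<alpha> \<partial>\<kappa>)\<close>, by linearity of the
  random measure. As \<open>f\<close> has finite range, the convergence of the exponents is the pointwise limit
  \<open>l * (\<phi> (t * l powr (-1/\<alpha>)) - 1) \<longlonglongrightarrow> - (\<sigma> \<bar>t\<bar>) powr \<alpha>\<close>, which is what the domain of attraction says
  about \<open>\<phi>\<close> near \<open>0\<close> (\<open>scaled_char_minus_1_tendsto\<close>).

  To pass from characteristic functions to joint laws, the continuity theorem is lifted from the real
  line to finite products (\<open>levy_continuity_PiM\<close>): coordinates are handled one at a time, the
  remaining ones being absorbed into a weight that changes the measure, and the Stone-Weierstrass
  theorem reduces a general test function to sums of products of functions of one coordinate.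
\<close>

section \<open>The continuity theorem in several dimensions\<close>

text \<open>
  A weight \<open>w\<close> that is bounded below by \<open>1\<close> turns \<open>M\<close> into a new probability measure without any
  division by a vanishing total mass; this makes the one-dimensional continuity theorem applicable to
  weighted integrals.
\<close>

lemma tilted_law:
  fixes w Z :: "'a \<Rightarrow> real"
  assumes "prob_space M" and [measurable]: "w \<in> borel_measurable M" "Z \<in> borel_measurable M"
    and w: "\<And>x. x \<in> space M \<Longrightarrow> 1 \<le> w x \<and> w x \<le> B"
  defines "a \<equiv> \<integral>x. w x \<partial>M"
  defines "T \<equiv> distr (density M (\<lambda>x. ennreal (w x / a))) borel Z"
  shows "1 \<le> a" "real_distribution T"
    and "\<And>f :: real \<Rightarrow> 'b :: {banach, second_countable_topology}. f \<in> borel_measurable borel \<Longrightarrow>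
           (\<integral>y. f y \<partial>T) = (1 / a) *\<^sub>R (\<integral>x. w x *\<^sub>R f (Z x) \<partial>M)"
proof -
  interpret prob_space M by fact
  have int: "integrable M w"
    by (rule integrable_const_bound[where B = B]) (use w in \<open>auto intro!: AE_I2 simp: abs_of_nonneg order_trans[OF zero_le_one]\<close>)
  have "(\<integral>x. 1 \<partial>M) \<le> a"
    unfolding a_def by (rule integral_mono) (use int w in auto)
  then show a: "1 \<le> a"
    by (simp add: prob_space)
  have wa: "0 \<le> w x / a" if "x \<in> space M" for x
    using w[OF that] a by (simp add: divide_nonneg_nonneg)
  have "(\<integral>\<^sup>+x. ennreal (w x / a) \<partial>M) = ennreal (\<integral>x. w x / a \<partial>M)"
    by (rule nn_integral_eq_integral) (use int wa in auto)
  also have "\<dots> = 1"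
    using a by (simp add: a_def)
  finally have "prob_space (density M (\<lambda>x. ennreal (w x / a)))"
    by (intro prob_spaceI) (simp add: emeasure_density cong: nn_integral_cong)
  then have "prob_space T"
    unfolding T_def by (rule prob_space.prob_space_distr) simp
  then show "real_distribution T"
    by (simp add: real_distribution_def real_distribution_axioms_def T_def)
  show "(\<integral>y. f y \<partial>T) = (1 / a) *\<^sub>R (\<integral>x. w x *\<^sub>R f (Z x) \<partial>M)"
    if [measurable]: "f \<in> borel_measurable borel" for f :: "real \<Rightarrow> 'b"
  proof -
    have "(\<integral>y. f y \<partial>T) = (\<integral>x. f (Z x) \<partial>density M (\<lambda>x. ennreal (w x / a)))"
      unfolding T_def by (rule integral_distr) auto
    also have "\<dots> = (\<integral>x. (w x / a) *\<^sub>R f (Z x) \<partial>M)"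
      by (rule integral_density) (use wa in auto)
    also have "\<dots> = (\<integral>x. (1 / a) *\<^sub>R (w x *\<^sub>R f (Z x)) \<partial>M)"
      by simp
    also have "\<dots> = (1 / a) *\<^sub>R (\<integral>x. w x *\<^sub>R f (Z x) \<partial>M)"
      by (subst integral_scaleR_right) auto
    finally show ?thesis .
  qed
qed

lemma weighted_levy_continuity_pos:
  fixes w Z :: "'a \<Rightarrow> real" and h :: "real \<Rightarrow> real"
  assumes M: "\<And>n. prob_space (M n)" "prob_space M'"
    and sets: "\<And>n. sets (M n) = sets N" "sets M' = sets N"
    and meas: "w \<in> borel_measurable N" "Z \<in> borel_measurable N"
    and w: "\<And>x. x \<in> space N \<Longrightarrow> 1 \<le> w x \<and> w x \<le> B"
    and conv: "\<And>t. (\<lambda>n. \<integral>x. w x *\<^sub>R iexp (t * Z x) \<partial>M n) \<longlonglongrightarrow> (\<integral>x. w x *\<^sub>R iexp (t * Z x) \<partial>M')"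
    and h: "continuous_on UNIV h" "\<And>y. \<bar>h y\<bar> \<le> C"
  shows "(\<lambda>n. \<integral>x. w x * h (Z x) \<partial>M n) \<longlonglongrightarrow> (\<integral>x. w x * h (Z x) \<partial>M')"
proof -
  have sp: "space (M n) = space N" "space M' = space N" for n
    using sets by (auto dest: sets_eq_imp_space_eq)
  have measM: "w \<in> borel_measurable (M n)" "Z \<in> borel_measurable (M n)"
    "w \<in> borel_measurable M'" "Z \<in> borel_measurable M'" for n
    using meas sets by (auto cong: measurable_cong_sets)
  define T where "T K = distr (density K (\<lambda>x. ennreal (w x / (\<integral>x. w x \<partial>K)))) borel Z" for K
  note tiltn = tilted_law[OF M(1) measM(1,2), unfolded sp, OF w, folded T_def]
  note tilt' = tilted_law[OF M(2) measM(3,4), unfolded sp, OF w, folded T_def]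
  have mass: "(\<lambda>n. \<integral>x. w x \<partial>M n) \<longlonglongrightarrow> (\<integral>x. w x \<partial>M')"
  proof -
    have "(\<lambda>n. Re (\<integral>x. complex_of_real (w x) \<partial>M n)) \<longlonglongrightarrow> Re (\<integral>x. complex_of_real (w x) \<partial>M')"
      using conv[of 0] by (intro tendsto_Re) (simp add: scaleR_conv_of_real)
    then show ?thesis by simp
  qed
  have ch: "char (T K) t = (1 / (\<integral>x. w x \<partial>K)) *\<^sub>R (\<integral>x. w x *\<^sub>R iexp (t * Z x) \<partial>K)"
    if "K \<in> insert M' (range M)" for K t
    using that by (auto simp: char_def tiltn(3) tilt'(3))
  have "weak_conv_m (\<lambda>n. T (M n)) (T M')"
  proof (rule levy_continuity)
    fix t
    have "(\<lambda>n. (1 / (\<integral>x. w x \<partial>M n)) *\<^sub>R (\<integral>x. w x *\<^sub>R iexp (t * Z x) \<partial>M n)) \<longlonglongrightarrow>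
       (1 / (\<integral>x. w x \<partial>M')) *\<^sub>R (\<integral>x. w x *\<^sub>R iexp (t * Z x) \<partial>M')"
      using tilt'(1) by (intro tendsto_intros conv mass) auto
    then show "(\<lambda>n. char (T (M n)) t) \<longlonglongrightarrow> char (T M') t"
      by (simp add: ch)
  qed (use tiltn(2) tilt'(2) in auto)
  then have lim: "(\<lambda>n. \<integral>y. h y \<partial>T (M n)) \<longlonglongrightarrow> (\<integral>y. h y \<partial>T M')"
    by (intro weak_conv_imp_integral_bdd_continuous_conv[where B = C])
      (use tiltn(2) tilt'(2) h in \<open>auto simp: continuous_on_eq_continuous_at\<close>)
  from lim have "(\<lambda>n. (\<integral>x. w x \<partial>M n) * (\<integral>y. h y \<partial>T (M n))) \<longlonglongrightarrow> (\<integral>x. w x \<partial>M') * (\<integral>y. h y \<partial>T M')"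
    by (intro tendsto_mult mass)
  moreover have "h \<in> borel_measurable borel"
    using h(1) by (rule borel_measurable_continuous_onI)
  moreover have "(\<integral>x. w x \<partial>M n) \<noteq> 0" "(\<integral>x. w x \<partial>M') \<noteq> 0" for n
    using tiltn(1)[of n] tilt'(1) by linarith+
  ultimately show ?thesis
    by (simp add: tiltn(3) tilt'(3))
qed

text \<open>
  Weights of arbitrary sign reduce to weights that are at least \<open>1\<close> by adding the constant \<open>B + 1\<close>,
  whose contribution converges by the unweighted hypothesis \<open>conv1\<close>. Cosines with arbitrary phase
  replace the complex exponential so that everything stays real.
\<close>

lemma weighted_levy_continuity:
  fixes w Z :: "'a \<Rightarrow> real" and h :: "real \<Rightarrow> real"
  assumes M: "\<And>n. prob_space (M n)" "prob_space M'"
    and sets: "\<And>n. sets (M n) = sets N" "sets M' = sets N"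
    and meas: "w \<in> borel_measurable N" "Z \<in> borel_measurable N"
    and w: "\<And>x. x \<in> space N \<Longrightarrow> \<bar>w x\<bar> \<le> B"
    and conv: "\<And>c t. (\<lambda>n. \<integral>x. w x * cos (c + t * Z x) \<partial>M n) \<longlonglongrightarrow> (\<integral>x. w x * cos (c + t * Z x) \<partial>M')"
    and conv1: "\<And>c t. (\<lambda>n. \<integral>x. cos (c + t * Z x) \<partial>M n) \<longlonglongrightarrow> (\<integral>x. cos (c + t * Z x) \<partial>M')"
    and h: "continuous_on UNIV h" "\<And>y. \<bar>h y\<bar> \<le> C"
  shows "(\<lambda>n. \<integral>x. w x * h (Z x) \<partial>M n) \<longlonglongrightarrow> (\<integral>x. w x * h (Z x) \<partial>M')"
proof -
  have mK: "w \<in> borel_measurable K" "Z \<in> borel_measurable K" 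
    "prob_space K" "space K = space N" if "K \<in> insert M' (range M)" for K
    using that meas sets M by (auto cong: measurable_cong_sets dest: sets_eq_imp_space_eq)
  have [measurable]: "h \<in> borel_measurable borel"
    using h(1) by (rule borel_measurable_continuous_onI)
  have intK: "integrable K (\<lambda>x. w x * g (Z x))" "integrable K (\<lambda>x. g (Z x))"
    if K: "K \<in> insert M' (range M)" and [measurable]: "g \<in> borel_measurable borel"
      and g: "\<And>y. \<bar>g y\<bar> \<le> D" for K D and g :: "real \<Rightarrow> real"
  proof -
    interpret K: prob_space K using mK K by auto
    note [measurable] = mK(1,2)[OF K]
    show "integrable K (\<lambda>x. w x * g (Z x))"
      by (rule K.integrable_const_bound[where B = "B * D"])
        (use w g mK(4)[OF K] in \<open>auto intro!: AE_I2 mult_mono order_trans[OF abs_ge_zero] simp: abs_mult\<close>)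
    show "integrable K (\<lambda>x. g (Z x))"
      by (rule K.integrable_const_bound[where B = D]) (use g in \<open>auto intro!: AE_I2\<close>)
  qed
  have trig: "integrable K (\<lambda>x. w x * cos (c + t * Z x))" "integrable K (\<lambda>x. cos (c + t * Z x))"
    if K: "K \<in> insert M' (range M)" for K c t
    using intK[OF K, of "\<lambda>y. cos (c + t * y)" 1] by auto
  have split_h: "(\<integral>x. (w x + (B + 1)) * h (Z x) \<partial>K) =
      (\<integral>x. w x * h (Z x) \<partial>K) + (B + 1) * (\<integral>x. h (Z x) \<partial>K)"
    if K: "K \<in> insert M' (range M)" for K
    using intK[OF K, of h C] h by (simp add: distrib_right)
  have iexp_cos: "iexp u = complex_of_real (cos (0 + u)) + \<i> * complex_of_real (cos (- (pi / 2) + u))" for u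
    by (simp add: complex_eq_iff cos_diff flip: cis_conv_exp)
  have char_split: "(\<integral>x. iexp (t * Z x) \<partial>K) =
      complex_of_real (\<integral>x. cos (0 + t * Z x) \<partial>K) + \<i> * complex_of_real (\<integral>x. cos (- (pi / 2) + t * Z x) \<partial>K)"
    "(\<integral>x. w x *\<^sub>R iexp (t * Z x) \<partial>K) =
      complex_of_real (\<integral>x. w x * cos (0 + t * Z x) \<partial>K) + \<i> * complex_of_real (\<integral>x. w x * cos (- (pi / 2) + t * Z x) \<partial>K)"
    "integrable K (\<lambda>x. iexp (t * Z x))" "integrable K (\<lambda>x. w x *\<^sub>R iexp (t * Z x))"
    if K: "K \<in> insert M' (range M)" for K t
    unfolding iexp_cos
    using trig[OF K, of 0 t] trig[OF K, of "-(pi/2)" t]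
    by (simp_all del: add_0 add: scaleR_conv_of_real distrib_left mult.left_commute[of _ \<i>] flip: of_real_mult)
  have conv_iexp: "(\<lambda>n. \<integral>x. iexp (t * Z x) \<partial>M n) \<longlonglongrightarrow> (\<integral>x. iexp (t * Z x) \<partial>M')"
    "(\<lambda>n. \<integral>x. w x *\<^sub>R iexp (t * Z x) \<partial>M n) \<longlonglongrightarrow> (\<integral>x. w x *\<^sub>R iexp (t * Z x) \<partial>M')" for t
    unfolding char_split(1,2)[OF insertI1] char_split(1,2)[OF insertI2[OF rangeI]]
    by (intro tendsto_intros conv conv1)+
  have split_c: "(\<integral>x. (w x + (B + 1)) *\<^sub>R iexp (t * Z x) \<partial>K) =
      (\<integral>x. w x *\<^sub>R iexp (t * Z x) \<partial>K) + (B + 1) *\<^sub>R (\<integral>x. iexp (t * Z x) \<partial>K)"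
    if K: "K \<in> insert M' (range M)" for K t
    using char_split(3,4)[OF K, of t] by (simp add: scaleR_add_left)
  have A: "(\<lambda>n. \<integral>x. (w x + (B + 1)) * h (Z x) \<partial>M n) \<longlonglongrightarrow> (\<integral>x. (w x + (B + 1)) * h (Z x) \<partial>M')"
  proof (rule weighted_levy_continuity_pos[OF M sets, where w = "\<lambda>x. w x + (B + 1)" and Z = Z and h = h
        and B = "2 * B + 1" and C = C])
    show "(\<lambda>n. \<integral>x. (w x + (B + 1)) *\<^sub>R iexp (t * Z x) \<partial>M n) \<longlonglongrightarrow> (\<integral>x. (w x + (B + 1)) *\<^sub>R iexp (t * Z x) \<partial>M')" for t
      unfolding split_c[OF insertI1] split_c[OF insertI2[OF rangeI]]
      by (intro tendsto_intros conv_iexp)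
    show "1 \<le> w x + (B + 1) \<and> w x + (B + 1) \<le> 2 * B + 1" if "x \<in> space N" for x
      using w[OF that] by linarith
  qed (use meas h in auto)
  have B: "(\<lambda>n. \<integral>x. 1 * h (Z x) \<partial>M n) \<longlonglongrightarrow> (\<integral>x. 1 * h (Z x) \<partial>M')"
    by (rule weighted_levy_continuity_pos[OF M sets, where w = "\<lambda>_. 1" and Z = Z and h = h and B = 1 and C = C])
      (use meas h conv_iexp in auto)
  have "(\<lambda>n. (\<integral>x. (w x + (B + 1)) * h (Z x) \<partial>M n) - (B + 1) * (\<integral>x. 1 * h (Z x) \<partial>M n)) \<longlonglongrightarrow>
      (\<integral>x. (w x + (B + 1)) * h (Z x) \<partial>M') - (B + 1) * (\<integral>x. 1 * h (Z x) \<partial>M')"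
    by (intro tendsto_intros A B)
  then show ?thesis
    by (simp add: split_h)
qed

text \<open>
  The functions \<open>h j\<close> are brought in one coordinate at a time: the product over \<open>K\<close> times the cosine
  serves as the weight in \<open>weighted_levy_continuity\<close> for the next coordinate. The cosine over all of
  \<open>J\<close> stays in the statement to make the induction work, because multiplying it by \<open>cos (c' + t * x k)\<close>
  gives a sum of two cosines of the same form.
\<close>

lemma product_test_functions_converge:
  fixes \<mu> :: "nat \<Rightarrow> ('i \<Rightarrow> real) measure" and h :: "'i \<Rightarrow> real \<Rightarrow> real"
  assumes J: "finite J"
    and prob: "\<And>n. prob_space (\<mu> n)" "prob_space \<nu>"
    and sets: "\<And>n. sets (\<mu> n) = sets (Pi\<^sub>M J (\<lambda>_. borel))" "sets \<nu> = sets (Pi\<^sub>M J (\<lambda>_. borel))"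
    and conv: "\<And>\<theta>. (\<lambda>n. \<integral>x. iexp (\<Sum>j\<in>J. \<theta> j * x j) \<partial>\<mu> n) \<longlonglongrightarrow> (\<integral>x. iexp (\<Sum>j\<in>J. \<theta> j * x j) \<partial>\<nu>)"
    and K: "finite K" "K \<subseteq> J"
    and h: "\<And>j. j \<in> K \<Longrightarrow> continuous_on UNIV (h j) \<and> bounded (range (h j))"
  shows "(\<lambda>n. \<integral>x. (\<Prod>j\<in>K. h j (x j)) * cos (c + (\<Sum>j\<in>J. \<theta> j * x j)) \<partial>\<mu> n) \<longlonglongrightarrow>
           (\<integral>x. (\<Prod>j\<in>K. h j (x j)) * cos (c + (\<Sum>j\<in>J. \<theta> j * x j)) \<partial>\<nu>)"
proof -
  have base: "(\<lambda>n. \<integral>x. cos (c + (\<Sum>j\<in>J. \<theta> j * x j)) \<partial>\<mu> n) \<longlonglongrightarrow> (\<integral>x. cos (c + (\<Sum>j\<in>J. \<theta> j * x j)) \<partial>\<nu>)"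
    for \<theta> c
  proof -
    have eq: "(\<integral>x. cos (c + (\<Sum>j\<in>J. \<theta> j * x j)) \<partial>M) = Re (iexp c * (\<integral>x. iexp (\<Sum>j\<in>J. \<theta> j * x j) \<partial>M))"
      if M: "prob_space M" "sets M = sets (Pi\<^sub>M J (\<lambda>_. borel))" for M
    proof -
      interpret prob_space M by fact
      have [measurable]: "(\<lambda>x. \<Sum>j\<in>J. \<theta> j * x j) \<in> borel_measurable M"
        by (subst measurable_cong_sets[OF M(2) refl]) simp
      have "integrable M (\<lambda>x. iexp c * iexp (\<Sum>j\<in>J. \<theta> j * x j))"
        by (intro integrable_mult_right integrable_iexp borel_measurable_of_real) (auto simp del: of_real_sum)
      then have "Re (\<integral>x. iexp c * iexp (\<Sum>j\<in>J. \<theta> j * x j) \<partial>M) = (\<integral>x. Re (iexp c * iexp (\<Sum>j\<in>J. \<theta> j * x j)) \<partial>M)"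
        by (rule integral_Re[symmetric])
      also have "\<dots> = (\<integral>x. cos (c + (\<Sum>j\<in>J. \<theta> j * x j)) \<partial>M)"
        by (simp only: cis_conv_exp[symmetric] cis_mult) simp
      finally show ?thesis
        by (simp only: integral_mult_right_zero)
    qed
    show ?thesis
      unfolding eq[OF prob(1) sets(1)] eq[OF prob(2) sets(2)]
      by (intro tendsto_intros conv)
  qed
  from K h show ?thesis
  proof (induction K arbitrary: c \<theta> rule: finite_induct)
    case empty
    then show ?case using base by simp
  next
    case (insert k K)
    then have k: "k \<in> J" and KJ: "K \<subseteq> J" by auto
    note IH = insert.IH[OF KJ insert.prems(2)[OF insertI2]]
    have hm: "h j \<in> borel_measurable borel" if "j \<in> insert k K" for j
      using insert.prems(2)[OF that] by (auto intro: borel_measurable_continuous_onI)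
    have "\<exists>C. \<forall>y. \<bar>h j y\<bar> \<le> C" if "j \<in> insert k K" for j
      using insert.prems(2)[OF that] by (auto simp: bounded_iff)
    then obtain C where C: "\<And>j y. j \<in> insert k K \<Longrightarrow> \<bar>h j y\<bar> \<le> C j"
      by metis
    have bound: "\<bar>(\<Prod>j\<in>K. h j (x j)) * cos u\<bar> \<le> (\<Prod>j\<in>K. C j)" for x u
    proof -
      have "\<bar>(\<Prod>j\<in>K. h j (x j)) * cos u\<bar> \<le> (\<Prod>j\<in>K. \<bar>h j (x j)\<bar>) * 1"
        unfolding abs_mult abs_prod by (intro mult_left_mono prod_nonneg) auto
      also have "\<dots> \<le> (\<Prod>j\<in>K. C j)"
        using C by (auto intro: prod_mono)
      finally show ?thesis .
    qed
    define w where "w x = (\<Prod>j\<in>K. h j (x j)) * cos (c + (\<Sum>j\<in>J. \<theta> j * x j))" for x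
    have shift: "(\<Sum>j\<in>J. (\<theta> j + (if j = k then t else 0)) * x j) = (\<Sum>j\<in>J. \<theta> j * x j) + t * x k" for x \<theta> and t :: real
    proof -
      have "(\<theta> j + (if j = k then t else 0)) * x j = \<theta> j * x j + (if j = k then t * x k else 0)" for j
        by (simp add: distrib_right)
      then show ?thesis
        using J k by (simp add: sum.distrib)
    qed
    have "(\<lambda>n. \<integral>x. w x * h k (x k) \<partial>\<mu> n) \<longlonglongrightarrow> (\<integral>x. w x * h k (x k) \<partial>\<nu>)"
    proof (rule weighted_levy_continuity[OF prob sets, where w = w and Z = "\<lambda>x. x k" and h = "h k"
          and B = "\<Prod>j\<in>K. C j" and C = "C k"])
      have [measurable]: "(\<lambda>x. x j) \<in> borel_measurable (Pi\<^sub>M J (\<lambda>_. borel))" if "j \<in> J" for j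
        using that by simp
      have mh: "(\<lambda>x. h j (x j)) \<in> borel_measurable (Pi\<^sub>M J (\<lambda>_. borel))" if "j \<in> K" for j
        using that KJ by (intro measurable_compose[OF _ hm]) auto
      show "w \<in> borel_measurable (Pi\<^sub>M J (\<lambda>_. borel))"
        unfolding w_def by (intro borel_measurable_times borel_measurable_prod mh) measurable
      show "(\<lambda>x. x k) \<in> borel_measurable (Pi\<^sub>M J (\<lambda>_. borel))"
        using k by simp
      show "\<bar>w x\<bar> \<le> (\<Prod>j\<in>K. C j)" for x
        unfolding w_def by (rule bound)
      show "continuous_on UNIV (h k)" using insert.prems by auto
      show "\<bar>h k y\<bar> \<le> C k" for y using C by auto
      show "(\<lambda>n. \<integral>x. cos (c' + t * x k) \<partial>\<mu> n) \<longlonglongrightarrow> (\<integral>x. cos (c' + t * x k) \<partial>\<nu>)" for c' t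
        using base[of c' "\<lambda>j. 0 + (if j = k then t else 0)"] unfolding shift by simp
      show "(\<lambda>n. \<integral>x. w x * cos (c' + t * x k) \<partial>\<mu> n) \<longlonglongrightarrow> (\<integral>x. w x * cos (c' + t * x k) \<partial>\<nu>)" for c' t
      proof -
        \<comment> \<open>The signs \<open>s = 1\<close> and \<open>s = -1\<close> give the two cosines of the product formula.\<close>
        define f where "f s x = (\<Prod>j\<in>K. h j (x j)) *
          cos ((c + s * c') + (\<Sum>j\<in>J. (\<theta> j + (if j = k then s * t else 0)) * x j))" for s x
        have eq: "w x * cos (c' + t * x k) = (1/2) * (f 1 x + f (-1) x)" for x
          unfolding w_def f_def shift
          by (simp add: mult.assoc cos_times_cos diff_divide_distrib) (simp add: algebra_simps add_divide_distrib)
        have int: "integrable M (f s)" if "prob_space M" "sets M = sets (Pi\<^sub>M J (\<lambda>_. borel))" for s M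
        proof (rule finite_measure.integrable_const_bound[OF prob_space.finite_measure[OF that(1)], where B = "\<Prod>j\<in>K. C j"])
          show "f s \<in> borel_measurable M"
            unfolding f_def measurable_cong_sets[OF that(2) refl]
            by (intro borel_measurable_times borel_measurable_prod mh) measurable
          have "\<bar>f s x\<bar> \<le> (\<Prod>j\<in>K. C j)" for x
            unfolding f_def by (rule bound)
          then show "AE x in M. norm (f s x) \<le> (\<Prod>j\<in>K. C j)"
            by simp
        qed
        have "(\<lambda>n. integral\<^sup>L (\<mu> n) (f s)) \<longlonglongrightarrow> integral\<^sup>L \<nu> (f s)" for s
          unfolding f_def by (rule IH) auto
        then have "(\<lambda>n. (1/2) * (integral\<^sup>L (\<mu> n) (f 1) + integral\<^sup>L (\<mu> n) (f (-1)))) \<longlonglongrightarrow>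
            (1/2) * (integral\<^sup>L \<nu> (f 1) + integral\<^sup>L \<nu> (f (-1)))"
          by (intro tendsto_intros)
        then show ?thesis
          unfolding eq using int[OF prob(1) sets(1)] int[OF prob(2) sets(2)]
          by simp
      qed
    qed
    then show ?case
      using insert.hyps by (simp add: w_def mult_ac)
  qed
qed

text \<open>
  An algebra of test functions that separates points and whose members are measurable for the product
  \<open>\<sigma>\<close>-algebra; multiplied by cutoffs they fall under \<open>product_test_functions_converge\<close>.
\<close>

inductive tensor_sum :: "'i set \<Rightarrow> (('i \<Rightarrow> real) \<Rightarrow> real) \<Rightarrow> bool" for J where
  prod: "(\<And>j. continuous_on UNIV (h j)) \<Longrightarrow> tensor_sum J (\<lambda>x. c * (\<Prod>j\<in>J. h j (x j)))"
| add: "tensor_sum J f \<Longrightarrow> tensor_sum J g \<Longrightarrow> tensor_sum J (\<lambda>x. f x + g x)"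

lemma tensor_sum_mult:
  assumes "tensor_sum J f" "tensor_sum J g"
  shows "tensor_sum J (\<lambda>x. f x * g x)"
  using assms
proof (induction f)
  case (prod h c)
  note h = prod.hyps
  from prod.prems show ?case
  proof (induction g)
    case (prod h' c')
    have "tensor_sum J (\<lambda>x. (c * c') * (\<Prod>j\<in>J. h j (x j) * h' j (x j)))"
      by (rule tensor_sum.prod) (intro continuous_intros h prod.hyps)
    then show ?case
      by (simp add: prod.distrib mult_ac)
  next
    case (add f' g')
    then show ?case
      by (simp add: distrib_left tensor_sum.add)
  qed
next
  case (add f f')
  then show ?case
    by (simp add: distrib_right tensor_sum.add)
qed

lemma tensor_sum_continuous_on: "tensor_sum J f \<Longrightarrow> continuous_on S f"
proof (induction f rule: tensor_sum.induct)
  case (prod h c)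
  have "continuous_on S (\<lambda>x. h j (x j))" for j
    by (rule continuous_on_compose2[OF prod.hyps continuous_on_subset[OF continuous_on_product_coordinates]]) auto
  then show ?case
    by (intro continuous_intros)
qed (intro continuous_intros)

lemma tensor_sum_measurable:
  "tensor_sum J f \<Longrightarrow> f \<in> borel_measurable (Pi\<^sub>M J (\<lambda>_. borel))"
proof (induction f rule: tensor_sum.induct)
  case (prod h c)
  have "(\<lambda>x. h j (x j)) \<in> borel_measurable (Pi\<^sub>M J (\<lambda>_. borel))" if "j \<in> J" for j
    by (rule measurable_compose[OF _ borel_measurable_continuous_onI[OF prod.hyps]]) (simp add: that)
  then show ?case
    by (intro borel_measurable_times borel_measurable_prod) auto
qed measurable

text \<open>
  The Stone-Weierstrass theorem on a box. Only the finitely many coordinates in \<open>J\<close> matter, so an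
  injection of \<open>J\<close> carries the box over to functions on \<open>nat\<close>, which form a metric space.
\<close>

lemma tensor_sum_approximation:
  assumes J: "finite J" and \<phi>: "continuous_map (product_topology (\<lambda>_. euclideanreal) J) euclideanreal \<phi>"
    and e: "0 < e"
  shows "\<exists>p. tensor_sum J p \<and> (\<forall>x\<in>PiE J (\<lambda>_. {-T..T}). \<bar>\<phi> x - p x\<bar> < e)"
proof -
  define to where "to = to_nat_on J"
  have to: "inj_on to J"
    unfolding to_def by (rule inj_on_to_nat_on[OF countable_finite[OF J]])
  define r where "r y = (\<lambda>j\<in>J. y (to j))" for y :: "nat \<Rightarrow> real"
  define S where "S = PiE (to ` J) (\<lambda>_. {-T..T})"
  define P where "P f \<longleftrightarrow> (\<exists>p. tensor_sum J p \<and> f = (\<lambda>y. p (r y)))" for f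
  have P_I: "P (\<lambda>y. p (r y))" if "tensor_sum J p" for p
    using that P_def by blast
  have r: "r ` S = PiE J (\<lambda>_. {-T..T})"
  proof safe
    fix x assume x: "x \<in> PiE J (\<lambda>_. {-T..T})"
    define y where "y = (\<lambda>i\<in>to ` J. x (the_inv_into J to i))"
    have "y \<in> S" "r y = x"
      using x the_inv_into_f_f[OF to] by (auto simp: y_def S_def r_def PiE_def extensional_def fun_eq_iff Pi_iff)
    then show "x \<in> r ` S" by blast
  qed (auto simp: r_def S_def)
  have "\<exists>f. P f \<and> (\<forall>y\<in>S. \<bar>(\<phi> \<circ> r) y - f y\<bar> < e)"
  proof (rule Stone_Weierstrass_HOL)
    have S: "S = PiE UNIV (\<lambda>i. if i \<in> to ` J then {-T..T} else {undefined})"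
      by (auto simp: S_def PiE_def Pi_def extensional_def split: if_splits)
    have "compactin (product_topology (\<lambda>_. euclideanreal) UNIV) S"
      unfolding S compactin_PiE by auto
    then show "compact S"
      by (simp add: euclidean_product_topology)
    show "P (\<lambda>x. c)" for c
      by (rule P_I[of "\<lambda>_. c"]) (use tensor_sum.prod[of "\<lambda>_ _. 1" J c] in simp)
    have cont_coord: "continuous_on S (\<lambda>y. y i)" for i
      by (rule continuous_on_subset[OF continuous_on_product_coordinates]) simp
    have "continuous_on S (\<lambda>y. r y j)" for j
      using cont_coord by (cases "j \<in> J") (auto simp: r_def)
    then have r_cont: "continuous_on S r"
      by (rule continuous_on_coordinatewise_then_product)
    show "continuous_on S f" if Pf: "P f" for f
    proof -
      obtain p where p: "tensor_sum J p" "f = (\<lambda>y. p (r y))"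
        using Pf unfolding P_def by (elim exE conjE)
      show ?thesis
        unfolding p(2) by (rule continuous_on_compose2[OF tensor_sum_continuous_on[OF p(1), of UNIV] r_cont]) simp
    qed
    show "P (\<lambda>x. f x + g x)" "P (\<lambda>x. f x * g x)" if fg: "P f \<and> P g" for f g
    proof -
      obtain p q where p: "tensor_sum J p" "f = (\<lambda>y. p (r y))" and q: "tensor_sum J q" "g = (\<lambda>y. q (r y))"
        using fg unfolding P_def by (elim conjE exE)
      show "P (\<lambda>x. f x + g x)" "P (\<lambda>x. f x * g x)"
        unfolding p(2) q(2)
        by (rule P_I[OF tensor_sum.add[OF p(1) q(1)]], rule P_I[OF tensor_sum_mult[OF p(1) q(1)]])
    qed
    show "\<exists>f. P f \<and> f x \<noteq> f y" if xy: "x \<in> S \<and> y \<in> S \<and> x \<noteq> y" for x y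
    proof -
      obtain j where j: "j \<in> J" "x (to j) \<noteq> y (to j)"
        using xy PiE_ext[of x "to ` J" "\<lambda>_. {-T..T}" y] unfolding S_def by blast
      have "tensor_sum J (\<lambda>x. 1 * (\<Prod>i\<in>J. (if i = j then x i else 1)))"
      proof (rule tensor_sum.prod[of "\<lambda>i u. if i = j then u else 1"])
        show "continuous_on UNIV (\<lambda>u::real. if i = j then u else 1)" for i
          by (cases "i = j") simp_all
      qed
      then have "tensor_sum J (\<lambda>x. x j)"
        using J j by simp
      then have "P (\<lambda>y. r y j)" by (rule P_I)
      moreover have "r x j \<noteq> r y j" using j by (simp add: r_def)
      ultimately show ?thesis by (intro exI conjI)
    qed
    have "continuous_map (top_of_set S) (product_topology (\<lambda>_. euclideanreal) J) r"
      unfolding continuous_map_componentwise using cont_coord by (auto simp: r_def)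
    from continuous_map_compose[OF this \<phi>] show "continuous_on S (\<phi> \<circ> r)"
      by simp
  qed (rule e)
  then show ?thesis
    unfolding P_def r[symmetric] by auto
qed

text \<open>
  The index type may be uncountable, so the Borel sets of the function space are of no help; the
  function is the pointwise limit of its approximations on growing boxes.
\<close>

lemma continuous_map_measurable_PiM:
  assumes J: "finite J" and \<phi>: "continuous_map (product_topology (\<lambda>_. euclideanreal) J) euclideanreal \<phi>"
  shows "\<phi> \<in> borel_measurable (Pi\<^sub>M J (\<lambda>_. borel))"
proof -
  have "\<exists>p. tensor_sum J p \<and> (\<forall>x\<in>PiE J (\<lambda>_. {- real n..real n}). \<bar>\<phi> x - p x\<bar> < 1 / real (Suc n))" for n
    by (rule tensor_sum_approximation[OF assms]) simp
  then obtain p where p: "\<And>n. tensor_sum J (p n)"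
    "\<And>n x. x \<in> PiE J (\<lambda>_. {- real n..real n}) \<Longrightarrow> \<bar>\<phi> x - p n x\<bar> < 1 / real (Suc n)"
    by metis
  show ?thesis
  proof (rule borel_measurable_LIMSEQ_real)
    show "p n \<in> borel_measurable (Pi\<^sub>M J (\<lambda>_. borel))" for n
      by (rule tensor_sum_measurable[OF p(1)])
    fix x :: "'a \<Rightarrow> real" assume x: "x \<in> space (Pi\<^sub>M J (\<lambda>_. borel))"
    obtain n0 where n0: "(\<Sum>j\<in>J. \<bar>x j\<bar>) \<le> real n0"
      using real_arch_simple by blast
    have in_box: "x \<in> PiE J (\<lambda>_. {- real n..real n})" if "n0 \<le> n" for n
    proof -
      have "\<bar>x j\<bar> \<le> real n" if "j \<in> J" for j
        using member_le_sum[of j J "\<lambda>j. \<bar>x j\<bar>"] J that n0 \<open>n0 \<le> n\<close> by force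
      then show ?thesis
        using x by (auto simp: space_PiM PiE_def abs_le_iff minus_le_iff)
    qed
    show "(\<lambda>n. p n x) \<longlonglongrightarrow> \<phi> x"
    proof (rule metric_LIMSEQ_I)
      fix e :: real assume "0 < e"
      then obtain n1 where n1: "1 / real (Suc n1) < e"
        using nat_approx_posE by blast
      have "dist (p n x) (\<phi> x) < e" if n: "max n0 n1 \<le> n" for n
      proof -
        have "1 / real (Suc n) \<le> 1 / real (Suc n1)"
          using n by (simp add: frac_le)
        then show ?thesis
          using p(2)[OF in_box, of n] n n1 by (simp add: dist_real_def abs_minus_commute)
      qed
      then show "\<exists>no. \<forall>n\<ge>no. dist (p n x) (\<phi> x) < e" by blast
    qed
  qed
qed

text \<open>
  A trapezoid if \<open>T > 0\<close>: \<open>1\<close> on \<open>[-T, T]\<close>, \<open>0\<close> outside \<open>[-2T, 2T]\<close>, linear in between.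
\<close>

definition cutoff :: "real \<Rightarrow> real \<Rightarrow> real" where
  "cutoff T r = max 0 (min 1 (2 - \<bar>r\<bar> / T))"

lemma cutoff_bounds:
  "continuous_on UNIV (cutoff T)" "0 \<le> cutoff T r" "cutoff T r \<le> 1"
  "0 < T \<Longrightarrow> \<bar>r\<bar> \<le> T \<Longrightarrow> cutoff T r = 1" "0 < T \<Longrightarrow> 2 * T < \<bar>r\<bar> \<Longrightarrow> cutoff T r = 0"
proof -
  have "continuous_on UNIV (\<lambda>r. max 0 (min 1 (2 - c * \<bar>r\<bar>)))" for c :: real
    by (intro continuous_intros)
  from this[of "inverse T"] show "continuous_on UNIV (cutoff T)"
    by (simp add: cutoff_def[abs_def] divide_inverse mult.commute)
qed (auto simp: cutoff_def field_simps)

text \<open>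
  Multiplying the approximation of \<open>\<phi>\<close> on a box by a product of cutoffs gives a sum of products of
  bounded functions, to which \<open>product_test_functions_converge\<close> applies. The error made outside the box
  is at most a bound of \<open>\<phi>\<close> times the mass that the cutoffs lose. Since the cutoffs are such products too, this mass converges
  to its value under \<open>\<nu>\<close>, so tightness of \<open>\<nu>\<close> controls the error for all large \<open>n\<close>.
\<close>

theorem levy_continuity_PiM:
  fixes \<mu> :: "nat \<Rightarrow> ('i \<Rightarrow> real) measure"
  assumes J: "finite J"
    and prob: "\<And>n. prob_space (\<mu> n)" "prob_space \<nu>"
    and sets: "\<And>n. sets (\<mu> n) = sets (Pi\<^sub>M J (\<lambda>_. borel))" "sets \<nu> = sets (Pi\<^sub>M J (\<lambda>_. borel))"
    and conv: "\<And>\<theta>. (\<lambda>n. \<integral>x. iexp (\<Sum>j\<in>J. \<theta> j * x j) \<partial>\<mu> n) \<longlonglongrightarrow> (\<integral>x. iexp (\<Sum>j\<in>J. \<theta> j * x j) \<partial>\<nu>)"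
  shows "weakly_converges (product_topology (\<lambda>_. euclideanreal) J) \<mu> \<nu> sequentially"
  unfolding weakly_converges_def
proof (intro allI impI, elim conjE)
  fix \<phi> assume \<phi>: "continuous_map (product_topology (\<lambda>_. euclideanreal) J) euclideanreal \<phi>"
    and "bounded (\<phi> ` topspace (product_topology (\<lambda>_. euclideanreal) J))"
  then obtain D where D: "\<And>x. x \<in> PiE J (\<lambda>_. UNIV) \<Longrightarrow> \<bar>\<phi> x\<bar> \<le> D" and D0: "0 < D"
    by (auto simp: bounded_pos)
  define K where "K = insert \<nu> (range \<mu>)"
  have K12: "prob_space M \<and> sets M = sets (Pi\<^sub>M J (\<lambda>_. borel))" if "M \<in> K" for M
    using that unfolding K_def by (elim insertE imageE; use prob sets in simp)
  then have K: "prob_space M" "sets M = sets (Pi\<^sub>M J (\<lambda>_. borel))" "space M = PiE J (\<lambda>_. UNIV)"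
    if "M \<in> K" for M
    using that K12[OF that, THEN conjunct2, THEN sets_eq_imp_space_eq] by (simp_all add: space_PiM)
  have \<phi>m: "\<phi> \<in> borel_measurable M" if "M \<in> K" for M
    unfolding measurable_cong_sets[OF K(2)[OF that] refl] by (rule continuous_map_measurable_PiM[OF J \<phi>])
  define bump where "bump \<equiv> \<lambda>T x. (\<Prod>j\<in>J. cutoff T (x j))"
  have bump_01: "0 \<le> bump T x" "bump T x \<le> 1" for T x
    unfolding bump_def by (auto intro!: prod_nonneg prod_le_1 cutoff_bounds)
  have bump_tensor: "tensor_sum J (bump T)" for T
    using tensor_sum.prod[of "\<lambda>_. cutoff T" J 1] cutoff_bounds(1) by (simp add: bump_def)
  have bump_measurable: "bump T \<in> borel_measurable M" if "M \<in> K" for M T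
    unfolding measurable_cong_sets[OF K(2)[OF that] refl] by (rule tensor_sum_measurable[OF bump_tensor])
  have bump_support: "x \<in> PiE J (\<lambda>_. {-(2*T)..2*T})" if "x \<in> PiE J (\<lambda>_. UNIV)" "bump T x \<noteq> 0" "0 < T" for x T
  proof -
    have "cutoff T (x j) \<noteq> 0" if "j \<in> J" for j
      using \<open>bump T x \<noteq> 0\<close> J that by (auto simp: bump_def)
    then have "\<bar>x j\<bar> \<le> 2 * T" if "j \<in> J" for j
      using cutoff_bounds(5)[OF \<open>0 < T\<close>, of "x j"] that by fastforce
    then show ?thesis
      using that(1) by (auto simp: PiE_def abs_le_iff minus_le_iff)
  qed
  have cut_conv: "(\<forall>M\<in>K. integrable M (\<lambda>x. p x * bump T x)) \<and>
      (\<lambda>n. \<integral>x. p x * bump T x \<partial>\<mu> n) \<longlonglongrightarrow> (\<integral>x. p x * bump T x \<partial>\<nu>)"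
    if p: "tensor_sum J p" and T: "0 < T" for p T
    using p
  proof (induction p rule: tensor_sum.induct)
    case (prod h c)
    have g: "continuous_on UNIV (\<lambda>u. h j u * cutoff T u) \<and> bounded (range (\<lambda>u. h j u * cutoff T u))" for j
    proof
      show "continuous_on UNIV (\<lambda>u. h j u * cutoff T u)"
        by (intro continuous_intros prod.hyps cutoff_bounds(1))
      have "compact (h j ` {-(2*T)..2*T})"
        by (intro compact_continuous_image continuous_on_subset[OF prod.hyps]) auto
      then obtain C where C: "\<And>u. u \<in> {-(2*T)..2*T} \<Longrightarrow> \<bar>h j u\<bar> \<le> C"
        using compact_imp_bounded by (fastforce simp: bounded_iff)
      have C0: "0 \<le> C" using C[of 0] T by fastforce
      have "\<bar>h j u * cutoff T u\<bar> \<le> C" for u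
      proof (cases "u \<in> {-(2*T)..2*T}")
        case True
        have "\<bar>h j u * cutoff T u\<bar> \<le> C * 1"
          unfolding abs_mult by (rule mult_mono) (use C[OF True] C0 cutoff_bounds(2,3)[of T u] in auto)
        then show ?thesis by simp
      next
        case False
        then have "cutoff T u = 0"
          by (intro cutoff_bounds(5)[OF T]) auto
        then show ?thesis using C0 by simp
      qed
      then show "bounded (range (\<lambda>u. h j u * cutoff T u))"
        by (auto simp: bounded_iff)
    qed
    have eq: "c * (\<Prod>j\<in>J. h j (x j)) * bump T x = c * (\<Prod>j\<in>J. h j (x j) * cutoff T (x j))" for x
      by (simp add: bump_def prod.distrib)
    have "\<exists>C. \<forall>u. \<bar>h j u * cutoff T u\<bar> \<le> C" for j
      using g[of j] by (auto simp: bounded_iff)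
    then obtain C where C: "\<And>j u. \<bar>h j u * cutoff T u\<bar> \<le> C j"
      by metis
    have int: "integrable M (\<lambda>x. c * (\<Prod>j\<in>J. h j (x j)) * bump T x)" if M: "M \<in> K" for M
    proof (rule finite_measure.integrable_const_bound[OF prob_space.finite_measure[OF K(1)[OF M]], where B = "\<bar>c\<bar> * (\<Prod>j\<in>J. C j)"])
      have "\<bar>c * (\<Prod>j\<in>J. h j (x j)) * bump T x\<bar> \<le> \<bar>c\<bar> * (\<Prod>j\<in>J. C j)" for x
        unfolding eq abs_mult abs_prod using C by (intro mult_left_mono prod_mono) (auto simp: abs_mult)
      then show "AE x in M. norm (c * (\<Prod>j\<in>J. h j (x j)) * bump T x) \<le> \<bar>c\<bar> * (\<Prod>j\<in>J. C j)"
        by simp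
      show "(\<lambda>x. c * (\<Prod>j\<in>J. h j (x j)) * bump T x) \<in> borel_measurable M"
        unfolding measurable_cong_sets[OF K(2)[OF M] refl]
        by (intro tensor_sum_measurable tensor_sum_mult tensor_sum.prod prod.hyps bump_tensor)
    qed
    have "(\<lambda>n. \<integral>x. (\<Prod>j\<in>J. h j (x j) * cutoff T (x j)) * cos (0 + (\<Sum>j\<in>J. 0 * x j)) \<partial>\<mu> n) \<longlonglongrightarrow>
        (\<integral>x. (\<Prod>j\<in>J. h j (x j) * cutoff T (x j)) * cos (0 + (\<Sum>j\<in>J. 0 * x j)) \<partial>\<nu>)"
      by (rule product_test_functions_converge[OF J prob sets conv J subset_refl g])
    then have "(\<lambda>n. \<integral>x. c * (\<Prod>j\<in>J. h j (x j)) * bump T x \<partial>\<mu> n) \<longlonglongrightarrow> (\<integral>x. c * (\<Prod>j\<in>J. h j (x j)) * bump T x \<partial>\<nu>)"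
      unfolding eq by (simp add: tendsto_mult_left)
    with int show ?case by blast
  next
    case (add f g)
    have i: "integrable M (\<lambda>x. f x * bump T x)" "integrable M (\<lambda>x. g x * bump T x)" if "M \<in> K" for M
      using add.IH that by auto
    have "(\<lambda>n. (\<integral>x. f x * bump T x \<partial>\<mu> n) + (\<integral>x. g x * bump T x \<partial>\<mu> n)) \<longlonglongrightarrow>
       (\<integral>x. f x * bump T x \<partial>\<nu>) + (\<integral>x. g x * bump T x \<partial>\<nu>)"
      using add.IH by (intro tendsto_intros) auto
    then show ?case
      using i by (simp add: distrib_right K_def)
  qed
  have bump_lim: "(\<lambda>n. \<integral>x. bump (real (Suc n)) x \<partial>\<nu>) \<longlonglongrightarrow> 1"
  proof -
    interpret \<nu>: prob_space \<nu> by fact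
    have "(\<lambda>n. \<integral>x. bump (real (Suc n)) x \<partial>\<nu>) \<longlonglongrightarrow> (\<integral>x. 1 \<partial>\<nu>)"
    proof (rule integral_dominated_convergence[where w = "\<lambda>_. 1"])
      have "(\<lambda>n. bump (real (Suc n)) x) \<longlonglongrightarrow> 1" for x
      proof -
        have "(\<lambda>n. cutoff (real (Suc n)) (x j)) \<longlonglongrightarrow> 1" for j
        proof (rule tendsto_eventually)
          obtain n0 where "\<bar>x j\<bar> \<le> real n0" using real_arch_simple by blast
          then show "\<forall>\<^sub>F n in sequentially. cutoff (real (Suc n)) (x j) = 1"
            by (intro eventually_sequentiallyI[of n0] cutoff_bounds(4)) auto
        qed
        then have "(\<lambda>n. bump (real (Suc n)) x) \<longlonglongrightarrow> (\<Prod>j\<in>J. 1)"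
          unfolding bump_def by (intro tendsto_prod)
        then show ?thesis by simp
      qed
      then show "AE x in \<nu>. (\<lambda>n. bump (real (Suc n)) x) \<longlonglongrightarrow> 1" by simp
    qed (use bump_measurable[of \<nu>] bump_01 in \<open>auto simp: K_def\<close>)
    then show ?thesis by (simp add: \<nu>.prob_space)
  qed
  show "(\<lambda>n. integral\<^sup>L (\<mu> n) \<phi>) \<longlonglongrightarrow> integral\<^sup>L \<nu> \<phi>"
  proof (rule LIMSEQ_I)
    fix r :: real assume "0 < r"
    \<comment> \<open>The error is at most \<open>3 * e + 3 * D * e\<close>: three times \<open>e\<close> from \<open>p\<close>, and masses \<open>e\<close> and \<open>2 * e\<close> lost under \<open>\<nu>\<close> and \<open>\<mu> n\<close>.\<close>
    define e where "e = r / (4 + 4 * D)"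
    have e: "0 < e" "(4 + 4 * D) * e = r" using \<open>0 < r\<close> D0 by (auto simp: e_def)
    obtain m where m: "\<bar>(\<integral>x. bump (real (Suc m)) x \<partial>\<nu>) - 1\<bar> < e"
      using LIMSEQ_D[OF bump_lim e(1)] by auto
    define T where "T = real (Suc m)"
    have T: "0 < T" by (simp add: T_def)
    obtain p where p: "tensor_sum J p" "\<And>x. x \<in> PiE J (\<lambda>_. {-(2*T)..2*T}) \<Longrightarrow> \<bar>\<phi> x - p x\<bar> < e"
      using tensor_sum_approximation[OF J \<phi> e(1)] by blast
    have "(\<lambda>n. \<integral>x. p x * bump T x \<partial>\<mu> n) \<longlonglongrightarrow> (\<integral>x. p x * bump T x \<partial>\<nu>)"
      using cut_conv[OF p(1) T] by blast
    from LIMSEQ_D[OF this e(1)] obtain n1 where n1: 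
      "\<And>n. n1 \<le> n \<Longrightarrow> \<bar>(\<integral>x. p x * bump T x \<partial>\<mu> n) - (\<integral>x. p x * bump T x \<partial>\<nu>)\<bar> < e"
      by auto
    have "(\<lambda>n. \<integral>x. 1 * bump T x \<partial>\<mu> n) \<longlonglongrightarrow> (\<integral>x. 1 * bump T x \<partial>\<nu>)"
      using cut_conv[of "\<lambda>_. 1", OF _ T] tensor_sum.prod[of "\<lambda>_ _. 1" J 1] by simp
    from LIMSEQ_D[OF this e(1)] obtain n2 where n2: 
      "\<And>n. n2 \<le> n \<Longrightarrow> \<bar>(\<integral>x. bump T x \<partial>\<mu> n) - (\<integral>x. bump T x \<partial>\<nu>)\<bar> < e"
      by auto
    have close: "\<bar>integral\<^sup>L M \<phi> - (\<integral>x. p x * bump T x \<partial>M)\<bar> \<le> D * (1 - (\<integral>x. bump T x \<partial>M)) + e"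
      if "M \<in> K" for M
    proof -
      interpret M: prob_space M using K that by auto
      have i1: "integrable M \<phi>"
        by (rule M.integrable_const_bound[where B = D]) (use \<phi>m that K D in auto)
      have i2: "integrable M (bump T)"
        by (rule M.integrable_const_bound[where B = 1]) (use bump_measurable that bump_01 in auto)
      have i3: "integrable M (\<lambda>x. p x * bump T x)"
        using cut_conv[OF p(1) T] that by blast
      have "\<bar>integral\<^sup>L M \<phi> - (\<integral>x. p x * bump T x \<partial>M)\<bar> = \<bar>\<integral>x. \<phi> x - p x * bump T x \<partial>M\<bar>"
        using i1 i3 by simp
      also have "\<dots> \<le> (\<integral>x. \<bar>\<phi> x - p x * bump T x\<bar> \<partial>M)"
        by (rule integral_abs_bound)
      also have "\<dots> \<le> (\<integral>x. D * (1 - bump T x) + e \<partial>M)"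
      proof (rule integral_mono)
        fix x assume "x \<in> space M"
        then have x: "x \<in> PiE J (\<lambda>_. UNIV)" using K that by auto
        have "\<bar>\<phi> x - p x\<bar> * bump T x \<le> e * 1"
        proof (cases "bump T x = 0")
          case False
          then show ?thesis
            using p(2)[OF bump_support[OF x _ T]] bump_01[of T x] e by (intro mult_mono) auto
        qed (use e in auto)
        moreover have "\<bar>\<phi> x\<bar> * (1 - bump T x) \<le> D * (1 - bump T x)"
          using D[OF x] bump_01[of T x] by (intro mult_right_mono) auto
        moreover have "\<bar>\<phi> x - p x * bump T x\<bar> \<le> \<bar>\<phi> x\<bar> * (1 - bump T x) + \<bar>\<phi> x - p x\<bar> * bump T x"
        proof -
          have "\<phi> x - p x * bump T x = \<phi> x * (1 - bump T x) + (\<phi> x - p x) * bump T x"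
            by (simp add: algebra_simps)
          then show ?thesis
            using abs_triangle_ineq[of "\<phi> x * (1 - bump T x)" "(\<phi> x - p x) * bump T x"] bump_01[of T x]
            by (simp add: abs_mult)
        qed
        ultimately show "\<bar>\<phi> x - p x * bump T x\<bar> \<le> D * (1 - bump T x) + e"
          by linarith
      qed (use i1 i2 i3 in auto)
      also have "\<dots> = D * (1 - (\<integral>x. bump T x \<partial>M)) + e"
        using i2 by (simp add: M.prob_space)
      finally show ?thesis .
    qed
    show "\<exists>n0. \<forall>n\<ge>n0. norm (integral\<^sup>L (\<mu> n) \<phi> - integral\<^sup>L \<nu> \<phi>) < r"
    proof (intro exI[of _ "max n1 n2"] allI impI)
      fix n assume n: "max n1 n2 \<le> n"
      have "1 - (\<integral>x. bump T x \<partial>\<nu>) \<le> e" using m by (simp add: T_def)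
      then have a: "D * (1 - (\<integral>x. bump T x \<partial>\<nu>)) \<le> D * e"
        using D0 by simp
      have "1 - (\<integral>x. bump T x \<partial>\<mu> n) \<le> 2 * e"
        using m n2[of n] n by (simp add: T_def)
      then have b: "D * (1 - (\<integral>x. bump T x \<partial>\<mu> n)) \<le> D * (2 * e)"
        using D0 by simp
      have "0 < D * e" using D0 e by simp
      then show "norm (integral\<^sup>L (\<mu> n) \<phi> - integral\<^sup>L \<nu> \<phi>) < r"
        using close[of \<nu>] close[of "\<mu> n"] n1[of n] n a b e
        by (simp add: K_def algebra_simps)
    qed
  qed
qed

section \<open>Characteristic functions in the normal domain of attraction\<close>

lemma char_iid_normalized_sum:
  assumes "real_distribution G"
  shows "char (distr (Pi\<^sub>M UNIV (\<lambda>_::nat. G)) borel (\<lambda>y. c * (\<Sum>i=1..n. y i))) t = char G (t * c) ^ n"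
proof -
  interpret G: real_distribution G by fact
  let ?P = "Pi\<^sub>M UNIV (\<lambda>_::nat. G)"
  interpret P: prob_space ?P
    by (rule prob_space_PiM) (rule G.prob_space_axioms)
  have comp: "distr ?P borel (\<lambda>y. y i) = G" for i
  proof -
    have "distr ?P borel (\<lambda>y. y i) = distr ?P G (\<lambda>y. y i)"
      by (rule distr_cong) auto
    then show ?thesis
      using distr_PiM_component[of UNIV "\<lambda>_. G" i] G.prob_space_axioms by simp
  qed
  have meas [measurable]: "(\<lambda>y. y i) \<in> borel_measurable ?P" for i
    using measurable_component_singleton[of i UNIV "\<lambda>_. G"] by (simp cong: measurable_cong_sets)
  have "sets (Pi\<^sub>M UNIV (\<lambda>_::nat. borel :: real measure)) = sets ?P"
    by (rule sets_PiM_cong) auto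
  then have "distr ?P (Pi\<^sub>M UNIV (\<lambda>_. borel)) (\<lambda>y. \<lambda>i\<in>UNIV. y i) = ?P"
    using distr_id2[of "Pi\<^sub>M UNIV (\<lambda>_::nat. borel)" ?P] by (simp add: restrict_def)
  then have "P.indep_vars (\<lambda>_. borel) (\<lambda>i y. y i) UNIV"
    by (subst P.indep_vars_iff_distr_eq_PiM') (auto simp: comp)
  then have ind: "P.indep_vars (\<lambda>_. borel) (\<lambda>i y. y i) {1..n}"
    by (rule P.indep_vars_subset) auto
  have "char (distr ?P borel (\<lambda>y. c * (\<Sum>i=1..n. y i))) t = char (distr ?P borel (\<lambda>y. \<Sum>i=1..n. y i)) (t * c)"
    by (simp add: char_def integral_distr mult.assoc)
  also have "\<dots> = (\<Prod>i=1..n. char (distr ?P borel (\<lambda>y. y i)) (t * c))"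
    by (rule P.char_distr_sum[OF ind])
  finally show ?thesis
    by (simp add: comp)
qed

text \<open>
  One exponential limit determines \<open>z\<close> only modulo \<open>2 * pi * \<i>\<close>; knowing it for all multiples \<open>s * z\<close>
  removes the ambiguity. Real parts follow by taking norms. For the
  imaginary parts \<open>y\<close>, integrating \<open>iexp (s * y) \<longlonglongrightarrow> 1\<close> over a Gaussian \<open>s\<close> gives
  \<open>exp (- y\<^sup>2 / 2) \<longlonglongrightarrow> 1\<close>.
\<close>

lemma tendsto_of_exp_multiples:
  fixes z :: "real \<Rightarrow> complex" and c :: real
  assumes "\<And>s::real. 0 < s \<Longrightarrow> ((\<lambda>l. exp (of_real s * z l)) \<longlongrightarrow> exp (of_real (s * c))) at_top"
  shows "(z \<longlongrightarrow> of_real c) at_top"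
proof (rule tendsto_at_topI_sequentially)
  fix X :: "nat \<Rightarrow> real" assume X: "filterlim X at_top sequentially"
  define w where "w k = z (X k) - of_real c" for k
  have ew: "(\<lambda>k. exp (of_real s * w k)) \<longlonglongrightarrow> 1" if "0 < s" for s :: real
  proof -
    have "(\<lambda>k. exp (of_real s * z (X k)) / exp (of_real (s * c))) \<longlonglongrightarrow> exp (of_real (s * c)) / exp (of_real (s * c) :: complex)"
      by (intro tendsto_divide tendsto_const filterlim_compose[OF assms[OF that] X]) simp
    then show ?thesis
      by (simp add: w_def right_diff_distrib exp_diff)
  qed
  have "(\<lambda>k. norm (exp (of_real 1 * w k))) \<longlonglongrightarrow> norm (1::complex)"
    by (intro tendsto_norm ew) simp
  then have "(\<lambda>k. exp (Re (w k))) \<longlonglongrightarrow> 1"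
    by simp
  from tendsto_ln[OF this] have re: "(\<lambda>k. Re (w k)) \<longlonglongrightarrow> 0"
    by simp
  define y where "y k = Im (w k)" for k
  have pos: "(\<lambda>k. iexp (s * y k)) \<longlonglongrightarrow> 1" if "0 < s" for s
  proof -
    have "(\<lambda>k. exp (of_real s * w k) / of_real (exp (s * Re (w k)))) \<longlonglongrightarrow> 1 / of_real (exp (s * 0))"
      by (intro tendsto_divide tendsto_of_real tendsto_exp tendsto_mult tendsto_const ew re that) simp
    moreover have "exp (of_real s * w k) / of_real (exp (s * Re (w k))) = iexp (s * y k)" for k
    proof -
      have "of_real s * w k = of_real (s * Re (w k)) + \<i> * of_real (s * y k)"
        by (simp add: complex_eq_iff y_def)
      then show ?thesis
        by (simp add: exp_add exp_of_real[symmetric] del: of_real_mult)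
    qed
    ultimately show ?thesis by simp
  qed
  \<comment> \<open>Negative \<open>s\<close> by conjugation.\<close>
  have all: "(\<lambda>k. iexp (s * y k)) \<longlonglongrightarrow> 1" for s
  proof (cases s "0::real" rule: linorder_cases)
    case less
    then have "(\<lambda>k. cnj (iexp (- s * y k))) \<longlonglongrightarrow> cnj 1"
      by (intro tendsto_cnj pos) simp
    then show ?thesis
      by (simp add: exp_cnj)
  qed (use pos in auto)
  interpret N: real_distribution std_normal_distribution
    by (rule real_dist_normal_dist)
  have "(\<lambda>k. \<integral>s. iexp (y k * s) \<partial>std_normal_distribution) \<longlonglongrightarrow> (\<integral>s. 1 \<partial>std_normal_distribution)"
  proof (rule integral_dominated_convergence[where w = "\<lambda>_. 1"])
    show "AE s in std_normal_distribution. (\<lambda>k. iexp (y k * s)) \<longlonglongrightarrow> 1"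
      using all by (simp add: mult.commute)
  qed auto
  then have "(\<lambda>k. char std_normal_distribution (y k)) \<longlonglongrightarrow> 1"
    using N.prob_space by (simp add: char_def)
  then have "(\<lambda>k. Re (complex_of_real (exp (- (y k)\<^sup>2 / 2)))) \<longlonglongrightarrow> Re 1"
    unfolding char_std_normal_distribution by (rule tendsto_Re)
  then have "(\<lambda>k. exp (- (y k)\<^sup>2 / 2)) \<longlonglongrightarrow> 1"
    by simp
  from tendsto_ln[OF this] have "(\<lambda>k. - (y k)\<^sup>2 / 2) \<longlonglongrightarrow> 0"
    by simp
  from tendsto_mult[OF tendsto_const[of "-2"] this] have "(\<lambda>k. (y k)\<^sup>2) \<longlonglongrightarrow> 0"
    by simp
  from tendsto_real_sqrt[OF this] have "(\<lambda>k. \<bar>y k\<bar>) \<longlonglongrightarrow> 0"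
    by simp
  then have "y \<longlonglongrightarrow> 0"
    by (rule tendsto_rabs_zero_cancel)
  with re have "(\<lambda>k. Complex (Re (w k)) (y k)) \<longlonglongrightarrow> Complex 0 0"
    by (intro tendsto_Complex)
  then have "w \<longlonglongrightarrow> 0"
    by (simp add: y_def zero_complex.code[symmetric])
  from tendsto_add[OF this tendsto_const[of "of_real c"]]
  show "(\<lambda>k. z (X k)) \<longlonglongrightarrow> of_real c"
    by (simp add: w_def)
qed

lemma floor_ratio_tendsto: "((\<lambda>l. real (nat \<lfloor>l\<rfloor>) / l) \<longlongrightarrow> 1) at_top"
proof (rule tendsto_sandwich)
  show "\<forall>\<^sub>F l in at_top. 1 - 1 / l \<le> real (nat \<lfloor>l\<rfloor>) / l"
    using eventually_gt_at_top[of 0]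
  proof eventually_elim
    case (elim l)
    have "l - 1 \<le> real (nat \<lfloor>l\<rfloor>)" by linarith
    then have "(l - 1) / l \<le> real (nat \<lfloor>l\<rfloor>) / l"
      using elim by (intro divide_right_mono) auto
    then show ?case using elim by (simp add: diff_divide_distrib)
  qed
  show "\<forall>\<^sub>F l in at_top. real (nat \<lfloor>l\<rfloor>) / l \<le> 1"
    using eventually_gt_at_top[of 0] by eventually_elim (simp add: of_nat_floor)
  have "((\<lambda>l::real. 1 - 1 / l) \<longlongrightarrow> 1 - 0) at_top"
    by (intro tendsto_intros tendsto_divide_0[OF tendsto_const] filterlim_at_top_imp_at_infinity filterlim_ident)
  then show "((\<lambda>l::real. 1 - 1 / l) \<longlongrightarrow> 1) at_top" by simp
qed simp

context
  fixes \<alpha> \<sigma> :: real and G :: "real measure"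
  assumes \<alpha>: "0 < \<alpha>" and nda: "normal_domain_of_attraction \<alpha> \<sigma> G"
begin

lemma domain_of_attraction_distr: "real_distribution G"
  using nda by (simp add: normal_domain_of_attraction_def)

text \<open>
  The hypothesis concerns the integers \<open>n\<close>, the conclusion a real parameter \<open>l\<close>. With \<open>n = \<lfloor>l\<rfloor>\<close> the left
  side is the characteristic function of the \<open>n\<close>-th normalised sum at \<open>t * (n / l) powr (1 / \<alpha>)\<close>, a
  point that moves with \<open>l\<close> and tends to \<open>t\<close>. Realising the weak convergence as pointwise
  convergence (Skorohod) makes dominated convergence applicable to such moving points.
\<close>

lemma scaled_char_power_tendsto:
  "((\<lambda>l. char G (t * l powr (- 1 / \<alpha>)) ^ nat \<lfloor>l\<rfloor>) \<longlongrightarrow> of_real (exp (- (\<sigma> powr \<alpha>) * \<bar>t\<bar> powr \<alpha>))) at_top"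
proof (rule tendsto_at_topI_sequentially)
  fix l :: "nat \<Rightarrow> real" assume l: "filterlim l at_top sequentially"
  interpret G: real_distribution G by (rule domain_of_attraction_distr)
  define \<mu> where "\<mu> n = distr (Pi\<^sub>M UNIV (\<lambda>_::nat. G)) borel (\<lambda>y. real n powr (- 1 / \<alpha>) * (\<Sum>i=1..n. y i))" for n
  obtain S where S: "real_distribution S"
    and charS: "\<And>\<theta>. char S \<theta> = complex_of_real (exp (- (\<sigma> powr \<alpha>) * \<bar>\<theta>\<bar> powr \<alpha>))"
    and weak: "weak_conv_m \<mu> S"
    using nda unfolding normal_domain_of_attraction_def is_sas_law_def \<mu>_def by auto
  have \<mu>: "real_distribution (\<mu> n)" for n
  proof -
    have "(\<lambda>y. y i) \<in> borel_measurable (Pi\<^sub>M UNIV (\<lambda>_::nat. G))" for i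
      using measurable_component_singleton[of i UNIV "\<lambda>_. G"] by (simp cong: measurable_cong_sets)
    then show ?thesis
      unfolding \<mu>_def
      by (intro prob_space.real_distribution_distr prob_space_PiM G.prob_space_axioms
          borel_measurable_times borel_measurable_sum) auto
  qed
  define n where "n k = nat \<lfloor>l k\<rfloor>" for k
  have n_top: "filterlim n at_top sequentially"
    unfolding n_def
    by (intro filterlim_compose[OF filterlim_nat_sequentially] filterlim_compose[OF filterlim_floor_sequentially l])
  define \<tau> where "\<tau> k = t * (real (n k) / l k) powr (1 / \<alpha>)" for k
  have "(\<lambda>k. t * (real (n k) / l k) powr (1 / \<alpha>)) \<longlonglongrightarrow> t * 1 powr (1 / \<alpha>)"
    unfolding n_def
    by (intro tendsto_intros filterlim_compose[OF floor_ratio_tendsto l]) simp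
  then have \<tau>: "\<tau> \<longlonglongrightarrow> t"
    by (simp add: \<tau>_def[abs_def])
  have "weak_conv_m (\<lambda>k. \<mu> (n k)) S"
    using weak unfolding weak_conv_m_def weak_conv_def
    by (auto intro: filterlim_compose[OF _ n_top])
  from Skorohod[OF \<mu> S this] obtain \<Omega> :: "real measure" and Y_seq Y where
    "prob_space \<Omega>" and Yk: "\<And>k. Y_seq k \<in> borel_measurable \<Omega>" "\<And>k. distr \<Omega> borel (Y_seq k) = \<mu> (n k)"
    and Y: "Y \<in> borel_measurable \<Omega>" "distr \<Omega> borel Y = S"
    and conv: "\<And>x. x \<in> space \<Omega> \<Longrightarrow> (\<lambda>k. Y_seq k x) \<longlonglongrightarrow> Y x"
    unfolding measurable_lborel1 by metis
  interpret \<Omega>: prob_space \<Omega> by fact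
  note [measurable] = Yk(1) Y(1)
  have "(\<lambda>k. \<integral>x. iexp (\<tau> k * Y_seq k x) \<partial>\<Omega>) \<longlonglongrightarrow> (\<integral>x. iexp (t * Y x) \<partial>\<Omega>)"
  proof (rule integral_dominated_convergence[where w = "\<lambda>_. 1"])
    show "AE x in \<Omega>. (\<lambda>k. iexp (\<tau> k * Y_seq k x)) \<longlonglongrightarrow> iexp (t * Y x)"
      by (intro AE_I2 tendsto_intros \<tau> conv)
  qed auto
  moreover have "(\<integral>x. iexp (\<tau> k * Y_seq k x) \<partial>\<Omega>) = char (\<mu> (n k)) (\<tau> k)" for k
    by (simp add: char_def Yk(2)[symmetric] integral_distr)
  moreover have "(\<integral>x. iexp (t * Y x) \<partial>\<Omega>) = char S t"
    by (simp add: char_def Y(2)[symmetric] integral_distr)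
  ultimately have lim: "(\<lambda>k. char (\<mu> (n k)) (\<tau> k)) \<longlonglongrightarrow> char S t"
    by simp
  have "\<forall>\<^sub>F k in sequentially. 1 \<le> l k"
    using l by (auto simp: filterlim_at_top)
  then have "\<forall>\<^sub>F k in sequentially. char (\<mu> (n k)) (\<tau> k) = char G (t * l k powr (- 1 / \<alpha>)) ^ nat \<lfloor>l k\<rfloor>"
  proof eventually_elim
    case (elim k)
    then have "0 < real (n k)" "0 < l k" by (auto simp: n_def)
    then have "\<tau> k * real (n k) powr (- 1 / \<alpha>) = t * l k powr (- 1 / \<alpha>)"
      by (simp add: \<tau>_def powr_divide powr_minus field_simps)
    then show ?case
      unfolding \<mu>_def char_iid_normalized_sum[OF domain_of_attraction_distr] by (simp add: n_def)
  qed
  from Lim_transform_eventually[OF lim this]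
  show "(\<lambda>k. char G (t * l k powr (- 1 / \<alpha>)) ^ nat \<lfloor>l k\<rfloor>) \<longlonglongrightarrow> of_real (exp (- (\<sigma> powr \<alpha>) * \<bar>t\<bar> powr \<alpha>))"
    by (simp add: charS)
qed

lemma scaled_char_tendsto_1: "((\<lambda>l. char G (t * l powr (- 1 / \<alpha>))) \<longlongrightarrow> 1) at_top"
proof -
  interpret G: real_distribution G by (rule domain_of_attraction_distr)
  have "((\<lambda>l::real. l powr (- 1 / \<alpha>)) \<longlongrightarrow> 0) at_top"
    by (rule tendsto_neg_powr) (use \<alpha> filterlim_ident in auto)
  then have "((\<lambda>l. t * l powr (- 1 / \<alpha>)) \<longlongrightarrow> t * 0) at_top"
    by (intro tendsto_intros)
  from isCont_tendsto_compose[OF G.isCont_char this] show ?thesis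
    by (simp add: G.char_zero)
qed

text \<open>
  Replacing \<open>l\<close> by \<open>s * l\<close> and \<open>t\<close> by \<open>t * s powr (1 / \<alpha>)\<close> leaves \<open>t * l powr (- 1 / \<alpha>)\<close> unchanged, so the
  limit of \<open>exp\<close> of the logarithm is known for all its positive multiples, and
  \<open>tendsto_of_exp_multiples\<close> applies.
\<close>

lemma scaled_Ln_char_tendsto:
  "((\<lambda>l. of_real l * Ln (char G (t * l powr (- 1 / \<alpha>)))) \<longlongrightarrow> of_real (- (\<sigma> powr \<alpha> * \<bar>t\<bar> powr \<alpha>))) at_top"
proof (rule tendsto_of_exp_multiples)
  have main: "((\<lambda>l. exp (of_real l * Ln (char G (t * l powr (- 1 / \<alpha>))))) \<longlongrightarrow>
      of_real (exp (- (\<sigma> powr \<alpha>) * \<bar>t\<bar> powr \<alpha>))) at_top" for t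
  proof -
    define L where "L l = Ln (char G (t * l powr (- 1 / \<alpha>)))" for l
    have L0: "(L \<longlongrightarrow> 0) at_top"
      unfolding L_def using tendsto_Ln[OF scaled_char_tendsto_1] by simp
    \<comment> \<open>The fractional part of \<open>l\<close> contributes a bounded multiple of a vanishing logarithm.\<close>
    have frac: "((\<lambda>l. of_real (l - real (nat \<lfloor>l\<rfloor>)) * L l) \<longlongrightarrow> 0) at_top"
    proof (rule Lim_null_comparison[OF _ tendsto_norm_zero[OF L0]])
      show "\<forall>\<^sub>F l in at_top. norm (of_real (l - real (nat \<lfloor>l\<rfloor>)) * L l) \<le> norm (L l)"
        using eventually_ge_at_top[of 0]
      proof eventually_elim
        case (elim l)
        then have "\<bar>l - real (nat \<lfloor>l\<rfloor>)\<bar> \<le> 1" by linarith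
        then show ?case unfolding norm_mult norm_of_real by (rule mult_left_le_one_le[rotated 2]) auto
      qed
    qed
    have lim: "((\<lambda>l. char G (t * l powr (- 1 / \<alpha>)) ^ nat \<lfloor>l\<rfloor> * exp (of_real (l - real (nat \<lfloor>l\<rfloor>)) * L l))
        \<longlongrightarrow> of_real (exp (- (\<sigma> powr \<alpha>) * \<bar>t\<bar> powr \<alpha>)) * exp 0) at_top"
      by (intro tendsto_mult tendsto_exp scaled_char_power_tendsto frac)
    have "\<forall>\<^sub>F l in at_top. char G (t * l powr (- 1 / \<alpha>)) \<noteq> 0"
      by (rule tendsto_imp_eventually_ne[OF scaled_char_tendsto_1]) simp
    then have "\<forall>\<^sub>F l in at_top. char G (t * l powr (- 1 / \<alpha>)) ^ nat \<lfloor>l\<rfloor> * exp (of_real (l - real (nat \<lfloor>l\<rfloor>)) * L l)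
        = exp (of_real l * L l)"
    proof eventually_elim
      case (elim l)
      then have "char G (t * l powr (- 1 / \<alpha>)) ^ nat \<lfloor>l\<rfloor> = exp (of_real (real (nat \<lfloor>l\<rfloor>)) * L l)"
        unfolding L_def of_real_of_nat_eq by (subst exp_of_nat_mult) simp
      then show ?case
        by (simp flip: exp_add) (simp add: algebra_simps)
    qed
    from Lim_transform_eventually[OF lim this] show ?thesis
      by (simp add: L_def)
  qed
  fix s :: real assume s: "0 < s"
  have "filterlim (\<lambda>l. s * l) at_top at_top"
    by (rule filterlim_tendsto_pos_mult_at_top[OF tendsto_const s filterlim_ident])
  from filterlim_compose[OF main[of "t * s powr (1 / \<alpha>)"] this]
  have lim: "((\<lambda>l. exp (of_real (s * l) * Ln (char G (t * s powr (1 / \<alpha>) * (s * l) powr (- 1 / \<alpha>))))) \<longlongrightarrow>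
      of_real (exp (- (\<sigma> powr \<alpha>) * \<bar>t * s powr (1 / \<alpha>)\<bar> powr \<alpha>))) at_top" .
  have "\<forall>\<^sub>F l in at_top. exp (of_real (s * l) * Ln (char G (t * s powr (1 / \<alpha>) * (s * l) powr (- 1 / \<alpha>)))) =
      exp (of_real s * (of_real l * Ln (char G (t * l powr (- 1 / \<alpha>)))))"
    using eventually_gt_at_top[of 0]
  proof eventually_elim
    case (elim l)
    have "t * s powr (1 / \<alpha>) * (s * l) powr (- 1 / \<alpha>) = t * l powr (- 1 / \<alpha>)"
      using s elim by (simp add: powr_mult powr_minus field_simps)
    then show ?case by (simp only: of_real_mult mult.assoc)
  qed
  from Lim_transform_eventually[OF lim this]
  show "((\<lambda>l. exp (of_real s * (of_real l * Ln (char G (t * l powr (- 1 / \<alpha>)))))) \<longlongrightarrow>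
      exp (of_real (s * - (\<sigma> powr \<alpha> * \<bar>t\<bar> powr \<alpha>)))) at_top"
    using s \<alpha> by (simp add: abs_mult powr_mult powr_powr exp_of_real mult_ac flip: of_real_mult of_real_minus)
qed

text \<open>
  The characteristic function tends to \<open>1\<close>, so \<open>\<phi> - 1\<close> and \<open>Ln \<phi>\<close> agree up to a quadratic error.
\<close>

lemma scaled_char_minus_1_tendsto:
  "((\<lambda>l. of_real l * (char G (t * l powr (- 1 / \<alpha>)) - 1)) \<longlongrightarrow> of_real (- (\<sigma> powr \<alpha> * \<bar>t\<bar> powr \<alpha>))) at_top"
proof -
  define w where "w l = Ln (char G (t * l powr (- 1 / \<alpha>)))" for l
  define z where "z l = of_real l * w l" for l
  have z: "(z \<longlongrightarrow> of_real (- (\<sigma> powr \<alpha> * \<bar>t\<bar> powr \<alpha>))) at_top"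
    using scaled_Ln_char_tendsto[of t] by (simp add: z_def[abs_def] w_def)
  have w: "(w \<longlongrightarrow> 0) at_top"
    unfolding w_def using tendsto_Ln[OF scaled_char_tendsto_1] by simp
  have rem: "((\<lambda>l. of_real l * (exp (w l) - 1 - w l)) \<longlongrightarrow> 0) at_top"
  proof (rule Lim_null_comparison)
    have "((\<lambda>l. exp \<bar>Re (w l)\<bar> * (norm (z l) * norm (w l))) \<longlongrightarrow>
        exp \<bar>Re 0\<bar> * (norm (of_real (- (\<sigma> powr \<alpha> * \<bar>t\<bar> powr \<alpha>)) :: complex) * norm (0::complex))) at_top"
      by (intro tendsto_intros z w)
    then show "((\<lambda>l. exp \<bar>Re (w l)\<bar> * (norm (z l) * norm (w l))) \<longlongrightarrow> 0) at_top"
      by simp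
    show "\<forall>\<^sub>F l in at_top. norm (of_real l * (exp (w l) - 1 - w l)) \<le> exp \<bar>Re (w l)\<bar> * (norm (z l) * norm (w l))"
    proof (rule always_eventually, rule allI)
      fix l
      have "norm (exp (w l) - 1 - w l) \<le> exp \<bar>Re (w l)\<bar> * norm (w l) ^ 2"
        using Taylor_exp[of "w l" 1] by (simp add: numeral_2_eq_2 diff_diff_eq)
      then have "\<bar>l\<bar> * norm (exp (w l) - 1 - w l) \<le> \<bar>l\<bar> * (exp \<bar>Re (w l)\<bar> * norm (w l) ^ 2)"
        by (rule mult_left_mono) simp
      then show "norm (of_real l * (exp (w l) - 1 - w l)) \<le> exp \<bar>Re (w l)\<bar> * (norm (z l) * norm (w l))"
        by (simp add: norm_mult z_def power2_eq_square mult_ac)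
    qed
  qed
  have lim: "((\<lambda>l. of_real l * (exp (w l) - 1 - w l) + z l) \<longlongrightarrow> 0 + of_real (- (\<sigma> powr \<alpha> * \<bar>t\<bar> powr \<alpha>))) at_top"
    by (intro tendsto_intros rem z)
  have "\<forall>\<^sub>F l in at_top. char G (t * l powr (- 1 / \<alpha>)) \<noteq> 0"
    by (rule tendsto_imp_eventually_ne[OF scaled_char_tendsto_1]) simp
  then have "\<forall>\<^sub>F l in at_top. of_real l * (exp (w l) - 1 - w l) + z l = of_real l * (char G (t * l powr (- 1 / \<alpha>)) - 1)"
    by eventually_elim (simp add: w_def z_def algebra_simps)
  from Lim_transform_eventually[OF lim this] show ?thesis by simp
qed

end

section \<open>Integrals against a Poisson random measure\<close>

text \<open>
  Used for the intensity as well as for a realisation of the Poisson measure, and on both sides of the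
  convergence of the exponents.
\<close>

lemma integral_finite_range:
  fixes f :: "'a \<Rightarrow> real" and F :: "real \<Rightarrow> 'b :: {banach, second_countable_topology}"
  assumes fin: "finite (f ` space M)" and [measurable]: "f \<in> borel_measurable M"
    and supp: "emeasure M {x \<in> space M. f x \<noteq> 0} < \<infinity>" and F0: "F 0 = 0"
  shows "integrable M (\<lambda>x. F (f x))"
    and "(\<integral>x. F (f x) \<partial>M) = (\<Sum>y\<in>f ` space M - {0}. measure M {x \<in> space M. f x = y} *\<^sub>R F y)"
proof -
  define Y where "Y = f ` space M - {0}"
  define S where "S y = {x \<in> space M. f x = y}" for y
  have Y: "finite Y" using fin by (simp add: Y_def)
  have S: "S y \<in> sets M" for y unfolding S_def by measurable
  have S_fin: "emeasure M (S y) < \<infinity>" if "y \<in> Y" for y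
  proof -
    have "emeasure M (S y) \<le> emeasure M {x \<in> space M. f x \<noteq> 0}"
      by (rule emeasure_mono) (use that in \<open>auto simp: S_def Y_def\<close>)
    then show ?thesis using supp by (rule le_less_trans)
  qed
  have eq: "F (f x) = (\<Sum>y\<in>Y. indicator (S y) x *\<^sub>R F y)" if "x \<in> space M" for x
  proof (cases "f x = 0")
    case True
    then have "indicator (S y) x *\<^sub>R F y = 0" if "y \<in> Y" for y
      using that by (auto simp: S_def Y_def)
    then have "(\<Sum>y\<in>Y. indicator (S y) x *\<^sub>R F y) = 0"
      by (rule sum.neutral[rule_format])
    then show ?thesis using True F0 by simp
  next
    case False
    then have "f x \<in> Y" using that by (simp add: Y_def)
    have "(\<Sum>y\<in>Y. indicator (S y) x *\<^sub>R F y) = (\<Sum>y\<in>Y. if y = f x then F y else 0)"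
      using that by (intro sum.cong) (auto simp: S_def)
    then show ?thesis using Y \<open>f x \<in> Y\<close> by simp
  qed
  have int: "integrable M (\<lambda>x. indicator (S y) x *\<^sub>R F y)" if "y \<in> Y" for y
    using S S_fin[OF that] by (intro integrable_scaleR_left) (auto simp: integrable_indicator_iff)
  have "integrable M (\<lambda>x. F (f x)) \<longleftrightarrow> integrable M (\<lambda>x. \<Sum>y\<in>Y. indicator (S y) x *\<^sub>R F y)"
    by (rule Bochner_Integration.integrable_cong[OF refl eq])
  then show "integrable M (\<lambda>x. F (f x))"
    using int by auto
  have "(\<integral>x. F (f x) \<partial>M) = (\<integral>x. (\<Sum>y\<in>Y. indicator (S y) x *\<^sub>R F y) \<partial>M)"
    by (intro Bochner_Integration.integral_cong refl eq)
  also have "\<dots> = (\<Sum>y\<in>Y. \<integral>x. indicator (S y) x *\<^sub>R F y \<partial>M)"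
    by (intro Bochner_Integration.integral_sum int)
  also have "\<dots> = (\<Sum>y\<in>Y. measure M (S y) *\<^sub>R F y)"
    by (intro sum.cong refl) (use S S_fin in \<open>simp add: integrable_indicator_iff Int_absorb1 sets.sets_into_space\<close>)
  finally show "(\<integral>x. F (f x) \<partial>M) = (\<Sum>y\<in>f ` space M - {0}. measure M {x \<in> space M. f x = y} *\<^sub>R F y)"
    by (simp add: Y_def S_def)
qed

context
  fixes P :: "'w measure" and n :: "'e measure" and N :: "'w \<Rightarrow> 'e measure"
  assumes prm: "poisson_random_measure P n N"
begin

interpretation P: prob_space P
  using prm by (simp add: poisson_random_measure_def)

lemma prm_sets: "\<omega> \<in> space P \<Longrightarrow> sets (N \<omega>) = sets n"
  and prm_emeasure_measurable: "A \<in> sets n \<Longrightarrow> (\<lambda>\<omega>. emeasure (N \<omega>) A) \<in> borel_measurable P"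
  using prm by (simp_all add: poisson_random_measure_def)

lemma prm_space: "\<omega> \<in> space P \<Longrightarrow> space (N \<omega>) = space n"
  using prm_sets by (rule sets_eq_imp_space_eq)

lemma prm_measurable_cong: "\<omega> \<in> space P \<Longrightarrow> f \<in> borel_measurable (N \<omega>) \<longleftrightarrow> f \<in> borel_measurable n"
  using measurable_cong_sets[OF prm_sets refl] by blast

lemma prm_nn_integral_measurable:
  assumes "f \<in> borel_measurable n"
  shows "(\<lambda>\<omega>. \<integral>\<^sup>+x. f x \<partial>N \<omega>) \<in> borel_measurable P"
  using assms
proof induct
  case (cong f g)
  have "(\<lambda>\<omega>. \<integral>\<^sup>+x. f x \<partial>N \<omega>) \<in> borel_measurable P \<longleftrightarrow> (\<lambda>\<omega>. \<integral>\<^sup>+x. g x \<partial>N \<omega>) \<in> borel_measurable P"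
    by (intro measurable_cong nn_integral_cong) (simp add: prm_space cong.hyps)
  then show ?case using cong by simp
next
  case (set B)
  have "(\<lambda>\<omega>. \<integral>\<^sup>+x. indicator B x \<partial>N \<omega>) \<in> borel_measurable P \<longleftrightarrow> (\<lambda>\<omega>. emeasure (N \<omega>) B) \<in> borel_measurable P"
    by (intro measurable_cong nn_integral_indicator) (simp add: prm_sets set)
  then show ?case using prm_emeasure_measurable[OF set] by simp
next
  case (mult f c)
  have "(\<lambda>\<omega>. \<integral>\<^sup>+x. c * f x \<partial>N \<omega>) \<in> borel_measurable P \<longleftrightarrow> (\<lambda>\<omega>. c * \<integral>\<^sup>+x. f x \<partial>N \<omega>) \<in> borel_measurable P"
    by (intro measurable_cong nn_integral_cmult) (simp add: prm_measurable_cong mult)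
  then show ?case using mult by simp
next
  case (add f g)
  have "(\<lambda>\<omega>. \<integral>\<^sup>+x. f x + g x \<partial>N \<omega>) \<in> borel_measurable P \<longleftrightarrow>
      (\<lambda>\<omega>. (\<integral>\<^sup>+x. f x \<partial>N \<omega>) + (\<integral>\<^sup>+x. g x \<partial>N \<omega>)) \<in> borel_measurable P"
    by (intro measurable_cong nn_integral_add) (simp_all add: prm_measurable_cong add)
  then show ?case using add by (simp add: add_ac)
next
  case (seq F)
  have "(\<lambda>\<omega>. \<integral>\<^sup>+x. (SUP i. F i) x \<partial>N \<omega>) \<in> borel_measurable P \<longleftrightarrow>
      (\<lambda>\<omega>. SUP i. \<integral>\<^sup>+x. F i x \<partial>N \<omega>) \<in> borel_measurable P"
    unfolding SUP_apply
    by (intro measurable_cong nn_integral_monotone_convergence_SUP) (simp_all add: prm_measurable_cong seq)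
  then show ?case using seq by (simp add: image_comp)
qed

text \<open>
  The integral has the default value \<open>0\<close> where \<open>g\<close> is not integrable, so the set of these \<open>\<omega>\<close> has to be
  measurable as well.
\<close>

lemma prm_integral_measurable:
  fixes g :: "'e \<Rightarrow> real"
  assumes [measurable]: "g \<in> borel_measurable n"
  shows "(\<lambda>\<omega>. \<integral>x. g x \<partial>N \<omega>) \<in> borel_measurable P"
proof -
  define I where "I f \<omega> = (\<integral>\<^sup>+x. ennreal (f x) \<partial>N \<omega>)" for f :: "'e \<Rightarrow> real" and \<omega>
  have [measurable]: "I f \<in> borel_measurable P" if "f \<in> borel_measurable n" for f
    unfolding I_def using that by (intro prm_nn_integral_measurable) simp
  have eq: "(\<integral>x. g x \<partial>N \<omega>) =
      (if I (\<lambda>x. \<bar>g x\<bar>) \<omega> < \<infinity> then enn2real (I g \<omega>) - enn2real (I (\<lambda>x. - g x) \<omega>) else 0)"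
    if "\<omega> \<in> space P" for \<omega>
  proof (cases "integrable (N \<omega>) g")
    case True
    then show ?thesis
      by (simp add: real_lebesgue_integral_def integrable_iff_bounded I_def)
  next
    case False
    then have "\<not> I (\<lambda>x. \<bar>g x\<bar>) \<omega> < \<infinity>"
      using that by (simp add: integrable_iff_bounded I_def prm_measurable_cong)
    with False show ?thesis
      by (simp add: not_integrable_integral_eq)
  qed
  show ?thesis
    by (subst measurable_cong[OF eq]) auto
qed

text \<open>
  A realisation need not be integer valued, but the Poisson probabilities of the values \<open>k\<close> add up to
  \<open>1\<close>, which leaves no room for other values.
\<close>

lemma prm_count_distribution:
  assumes A: "A \<in> sets n" "emeasure n A < \<infinity>"
  shows prm_prob: "measure P {\<omega> \<in> space P. emeasure (N \<omega>) A = of_nat k} = exp (- measure n A) * measure n A ^ k / fact k"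
    and prm_AE_nat: "AE \<omega> in P. \<exists>k::nat. emeasure (N \<omega>) A = of_nat k"
proof -
  note [measurable] = prm_emeasure_measurable[OF A(1)]
  have prob: "measure P {\<omega> \<in> space P. emeasure (N \<omega>) A = of_nat k} = exp (- measure n A) * measure n A ^ k / fact k" for k
  proof -
    have "\<forall>(I::nat set) B. disjoint_family_on B I \<and> (\<forall>i\<in>I. B i \<in> sets n \<and> emeasure n (B i) < \<infinity>) \<longrightarrow>
        (\<forall>i\<in>I. \<forall>k::nat. measure P {\<omega>\<in>space P. emeasure (N \<omega>) (B i) = of_nat k} =
             exp (- measure n (B i)) * measure n (B i) ^ k / fact k)"
      using prm unfolding poisson_random_measure_def by blast
    from this[rule_format, of "\<lambda>_. A" "{0}" 0 k] show ?thesis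
      using A by (simp add: disjoint_family_on_def)
  qed
  then show "measure P {\<omega> \<in> space P. emeasure (N \<omega>) A = of_nat k} = exp (- measure n A) * measure n A ^ k / fact k" .
  define E where "E k = {\<omega> \<in> space P. emeasure (N \<omega>) A = of_nat k}" for k :: nat
  have E: "range E \<subseteq> P.events" unfolding E_def by auto
  have "disjoint_family E" by (auto simp: disjoint_family_on_def E_def)
  from P.finite_measure_UNION[OF E this] have "(\<lambda>k. exp (- measure n A) * measure n A ^ k / fact k) sums P.prob (\<Union>k. E k)"
    by (simp add: E_def prob)
  moreover have "(\<lambda>k. exp (- measure n A) * (measure n A ^ k /\<^sub>R fact k)) sums (exp (- measure n A) * exp (measure n A))"
    by (intro sums_mult exp_converges)
  ultimately have "P.prob (\<Union>k. E k) = 1"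
    by (simp add: sums_iff divide_inverse exp_minus mult_ac)
  then have "AE \<omega> in P. \<omega> \<in> (\<Union>k. E k)"
    using E by (subst P.AE_in_set_eq_1) auto
  then show "AE \<omega> in P. \<exists>k::nat. emeasure (N \<omega>) A = of_nat k"
    by eventually_elim (auto simp: E_def)
qed

lemma prm_AE_finite:
  assumes A: "A \<in> sets n" "emeasure n A < \<infinity>"
  shows "AE \<omega> in P. emeasure (N \<omega>) A < \<infinity>"
  using prm_AE_nat[OF A] by eventually_elim (auto simp: of_nat_less_top)

text \<open>
  Summing over the events that the count equals \<open>k\<close> gives the exponential series in
  \<open>measure n A *\<^sub>R iexp u\<close>.
\<close>

lemma prm_char_count:
  assumes A: "A \<in> sets n" "emeasure n A < \<infinity>"
  shows "(\<integral>\<omega>. iexp (u * measure (N \<omega>) A) \<partial>P) = exp (measure n A *\<^sub>R (iexp u - 1))"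
proof -
  note [measurable] = prm_emeasure_measurable[OF A(1)]
  define E where "E k = {\<omega> \<in> space P. emeasure (N \<omega>) A = of_nat k}" for k :: nat
  have E [measurable]: "E k \<in> P.events" for k unfolding E_def by measurable
  define f where "f k \<omega> = indicator (E k) \<omega> *\<^sub>R iexp (u * real k)" for k \<omega>
  have f_sums: "(\<lambda>k. f k \<omega>) sums f k0 \<omega>" if "\<omega> \<in> E k0" for \<omega> k0
  proof -
    have "f k \<omega> = 0" if "k \<noteq> k0" for k
      using \<open>\<omega> \<in> E k0\<close> that by (auto simp: f_def E_def)
    then have "(\<lambda>k. f k \<omega>) = (\<lambda>k. if k = k0 then f k \<omega> else 0)"
      by auto
    then show ?thesis
      using sums_single[of k0 "\<lambda>k. f k \<omega>"] by simp
  qed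
  have AE_E: "AE \<omega> in P. \<exists>k. \<omega> \<in> E k"
    using prm_AE_nat[OF A] by (rule AE_mp) (auto intro!: AE_I2 simp: E_def)
  have prob_E: "P.prob (E k) = exp (- measure n A) * measure n A ^ k / fact k" for k
    unfolding E_def by (rule prm_prob[OF A])
  have int_f: "integrable P (f k)" for k
    unfolding f_def by (intro integrable_scaleR_left) (auto simp: integrable_indicator_iff P.emeasure_eq_measure)
  have int_eq: "integral\<^sup>L P (f k) = exp (- measure n A) *\<^sub>R ((measure n A *\<^sub>R iexp u) ^ k /\<^sub>R fact k)" for k
  proof -
    have "integral\<^sup>L P (f k) = P.prob (E k) *\<^sub>R iexp (u * real k)"
      unfolding f_def by (simp add: P.emeasure_eq_measure Int_absorb1 sets.sets_into_space)
    also have "iexp (u * real k) = iexp u ^ k"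
      by (simp add: exp_of_nat_mult[symmetric] mult_ac)
    finally show ?thesis
      by (simp add: prob_E power_mult_distrib scaleR_conv_of_real divide_inverse)
  qed
  have norm_eq: "(\<integral>\<omega>. norm (f k \<omega>) \<partial>P) = exp (- measure n A) * (measure n A ^ k /\<^sub>R fact k)" for k
    unfolding f_def by (simp add: P.emeasure_eq_measure Int_absorb1 sets.sets_into_space prob_E divide_inverse)
  have "(\<integral>\<omega>. iexp (u * measure (N \<omega>) A) \<partial>P) = (\<integral>\<omega>. (\<Sum>k. f k \<omega>) \<partial>P)"
  proof (rule integral_cong_AE)
    show "(\<lambda>\<omega>. iexp (u * measure (N \<omega>) A)) \<in> borel_measurable P"
      unfolding measure_def by measurable
    show "(\<lambda>\<omega>. \<Sum>k. f k \<omega>) \<in> borel_measurable P"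
      unfolding f_def by measurable
    show "AE \<omega> in P. iexp (u * measure (N \<omega>) A) = (\<Sum>k. f k \<omega>)"
      using AE_E
    proof eventually_elim
      case (elim \<omega>)
      then obtain k where k: "\<omega> \<in> E k" by blast
      then have "measure (N \<omega>) A = real k"
        by (simp add: E_def measure_def)
      moreover have "(\<Sum>k. f k \<omega>) = f k \<omega>"
        using f_sums[OF k] by (simp add: sums_iff)
      ultimately show ?case using k by (simp add: f_def)
    qed
  qed
  also have "\<dots> = (\<Sum>k. integral\<^sup>L P (f k))"
  proof (rule integral_suminf[OF int_f])
    show "AE \<omega> in P. summable (\<lambda>k. norm (f k \<omega>))"
      using AE_E
    proof eventually_elim
      case (elim \<omega>)
      then obtain k0 where k: "\<omega> \<in> E k0" by blast
      have "norm (f k \<omega>) = 0" if "k \<notin> {k0}" for k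
        using k that by (auto simp: f_def E_def)
      then show ?case by (intro summable_finite[of "{k0}"]) auto
    qed
    show "summable (\<lambda>k. \<integral>\<omega>. norm (f k \<omega>) \<partial>P)"
      unfolding norm_eq by (intro summable_mult sums_summable[OF exp_converges])
  qed
  also have "\<dots> = exp (- measure n A) *\<^sub>R exp (measure n A *\<^sub>R iexp u)"
    unfolding int_eq by (intro sums_unique[symmetric] sums_scaleR_right exp_converges)
  also have "\<dots> = exp (measure n A *\<^sub>R (iexp u - 1))"
    by (simp add: scaleR_conv_of_real right_diff_distrib exp_diff exp_minus divide_inverse exp_of_real mult.commute)
  finally show ?thesis .
qed

lemma prm_char_simple:
  fixes g :: "'e \<Rightarrow> real"
  assumes g: "simple_function n g" and supp: "emeasure n {x \<in> space n. g x \<noteq> 0} < \<infinity>"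
  shows "(\<integral>\<omega>. iexp (\<integral>x. g x \<partial>N \<omega>) \<partial>P) = exp (\<integral>x. iexp (g x) - 1 \<partial>n)"
proof -
  have gm [measurable]: "g \<in> borel_measurable n" by (rule borel_measurable_simple_function[OF g])
  have fin: "finite (g ` space n)" using g by (simp add: simple_function_def)
  define Y where "Y = g ` space n - {0}"
  have Y: "finite Y" using fin by (simp add: Y_def)
  define S where "S y = {x \<in> space n. g x = y}" for y
  have S: "S y \<in> sets n" for y unfolding S_def by measurable
  have S_fin: "emeasure n (S y) < \<infinity>" if "y \<in> Y" for y
  proof -
    have "emeasure n (S y) \<le> emeasure n {x \<in> space n. g x \<noteq> 0}"
      by (rule emeasure_mono) (use that in \<open>auto simp: S_def Y_def\<close>)
    then show ?thesis using supp by (rule le_less_trans)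
  qed
  obtain e where e: "bij_betw e {..<card Y} Y"
    using ex_bij_betw_nat_finite[OF Y] by (auto simp: atLeast0LessThan)
  then have eY: "e i \<in> Y" if "i < card Y" for i
    using that by (auto simp: bij_betw_def)
  note [measurable] = prm_emeasure_measurable[OF S]
  have "\<forall>(I::nat set) A. disjoint_family_on A I \<and> (\<forall>i\<in>I. A i \<in> sets n \<and> emeasure n (A i) < \<infinity>) \<longrightarrow>
        P.indep_vars (\<lambda>_. borel) (\<lambda>i \<omega>. emeasure (N \<omega>) (A i)) I"
    using prm unfolding poisson_random_measure_def by blast
  moreover have "disjoint_family_on (\<lambda>i. S (e i)) {..<card Y}"
    using e by (auto simp: disjoint_family_on_def S_def bij_betw_def inj_on_def)
  ultimately have ind: "P.indep_vars (\<lambda>_. borel) (\<lambda>i \<omega>. emeasure (N \<omega>) (S (e i))) {..<card Y}"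
    using S S_fin eY by auto
  have ind': "P.indep_vars (\<lambda>_. borel) (\<lambda>i \<omega>. iexp (e i * measure (N \<omega>) (S (e i)))) {..<card Y}"
    unfolding measure_def by (rule P.indep_vars_compose2[OF ind]) measurable
  have "(\<integral>\<omega>. iexp (\<integral>x. g x \<partial>N \<omega>) \<partial>P) = (\<integral>\<omega>. (\<Prod>i<card Y. iexp (e i * measure (N \<omega>) (S (e i)))) \<partial>P)"
  proof (rule integral_cong_AE)
    note [measurable] = prm_integral_measurable[OF gm]
    show "(\<lambda>\<omega>. iexp (\<integral>x. g x \<partial>N \<omega>)) \<in> borel_measurable P" by measurable
    show "(\<lambda>\<omega>. \<Prod>i<card Y. iexp (e i * measure (N \<omega>) (S (e i)))) \<in> borel_measurable P"
      unfolding measure_def by measurable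
    have "{x \<in> space n. g x \<noteq> 0} \<in> sets n" by measurable
    from prm_AE_finite[OF this supp] AE_space
    show "AE \<omega> in P. iexp (\<integral>x. g x \<partial>N \<omega>) = (\<Prod>i<card Y. iexp (e i * measure (N \<omega>) (S (e i))))"
    proof eventually_elim
      case (elim \<omega>)
      note sp = prm_space[OF elim(2)]
      have "(\<integral>x. g x \<partial>N \<omega>) = (\<Sum>y\<in>Y. measure (N \<omega>) (S y) *\<^sub>R y)"
        using integral_finite_range(2)[of g "N \<omega>" "\<lambda>y. y"] fin elim prm_measurable_cong[OF elim(2), of g] gm
        by (simp add: sp Y_def S_def)
      also have "\<dots> = (\<Sum>i<card Y. e i * measure (N \<omega>) (S (e i)))"
        using sum.reindex_bij_betw[OF e, of "\<lambda>y. measure (N \<omega>) (S y) *\<^sub>R y"] by (simp add: mult.commute)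
      finally show ?case
        by (simp add: exp_sum sum_distrib_left)
    qed
  qed
  also have "\<dots> = (\<Prod>i<card Y. \<integral>\<omega>. iexp (e i * measure (N \<omega>) (S (e i))) \<partial>P)"
  proof (rule P.indep_vars_lebesgue_integral[OF _ ind'])
    show "integrable P (\<lambda>\<omega>. iexp (e i * measure (N \<omega>) (S (e i))))" for i
      by (rule P.integrable_const_bound[where B = 1]) (auto simp: measure_def)
  qed simp
  also have "\<dots> = (\<Prod>i<card Y. exp (measure n (S (e i)) *\<^sub>R (iexp (e i) - 1)))"
    by (intro prod.cong refl prm_char_count S S_fin eY) simp
  also have "\<dots> = exp (\<Sum>i<card Y. measure n (S (e i)) *\<^sub>R (iexp (e i) - 1))"
    by (simp add: exp_sum)
  also have "(\<Sum>i<card Y. measure n (S (e i)) *\<^sub>R (iexp (e i) - 1)) = (\<Sum>y\<in>Y. measure n (S y) *\<^sub>R (iexp y - 1))"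
    by (rule sum.reindex_bij_betw[OF e])
  also have "\<dots> = (\<integral>x. iexp (g x) - 1 \<partial>n)"
    using integral_finite_range(2)[OF fin gm supp, of "\<lambda>y. iexp y - 1"] by (simp add: Y_def S_def)
  finally show ?thesis .
qed

text \<open>
  The support contains finitely many points almost surely, and for large \<open>k\<close>
  none of them lies in the set where \<open>\<bar>g\<bar> > k\<close>, because the intensity of that set tends to \<open>0\<close>.
\<close>

lemma prm_AE_integrable:
  fixes g :: "'e \<Rightarrow> real"
  assumes g [measurable]: "g \<in> borel_measurable n" and supp: "emeasure n {x \<in> space n. g x \<noteq> 0} < \<infinity>"
  shows "AE \<omega> in P. integrable (N \<omega>) g"
proof -
  define D where "D = {x \<in> space n. g x \<noteq> 0}"
  define T where "T k = {x \<in> space n. g x \<noteq> 0 \<and> real k < \<bar>g x\<bar>}" for k :: nat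
  have D: "D \<in> sets n" and T: "T k \<in> sets n" for k
    unfolding D_def T_def by measurable
  have T_le: "emeasure n (T k) \<le> emeasure n D" for k
    by (rule emeasure_mono[OF _ D]) (auto simp: D_def T_def)
  have T_fin: "emeasure n (T k) < \<infinity>" for k
    using T_le[of k] supp by (simp add: D_def)
  have "(\<lambda>k. emeasure n (T k)) \<longlonglongrightarrow> emeasure n (\<Inter>k. T k)"
    using T T_fin by (intro Lim_emeasure_decseq) (auto simp: decseq_def T_def less_top[symmetric])
  moreover have "(\<Inter>k. T k) = {}"
  proof -
    have "\<exists>k. x \<notin> T k" for x
      using real_arch_simple[of "\<bar>g x\<bar>"] by (auto simp: T_def not_less)
    then show ?thesis by blast
  qed
  ultimately have "(\<lambda>k. emeasure n (T k)) \<longlonglongrightarrow> 0" by simp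
  then have "(\<lambda>k. measure n (T k)) \<longlonglongrightarrow> 0"
    unfolding measure_def by (intro tendsto_enn2real) simp_all
  then have lim: "(\<lambda>k. exp (- measure n (T k))) \<longlonglongrightarrow> exp (- 0)"
    by (intro tendsto_exp tendsto_minus)
  define Z where "Z = {\<omega> \<in> space P. \<exists>k. emeasure (N \<omega>) (T k) = 0}"
  note [measurable] = prm_emeasure_measurable[OF T]
  have Z: "Z \<in> P.events" unfolding Z_def by measurable
  have "exp (- measure n (T k)) \<le> P.prob Z" for k
  proof -
    have "P.prob {\<omega> \<in> space P. emeasure (N \<omega>) (T k) = 0} \<le> P.prob Z"
      by (rule P.finite_measure_mono[OF _ Z]) (auto simp: Z_def)
    then show ?thesis
      using prm_prob[OF T T_fin, of k 0] by simp
  qed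
  then have "exp (- 0) \<le> P.prob Z"
    by (intro LIMSEQ_le_const2[OF lim]) auto
  then have "P.prob Z = 1"
    using P.prob_le_1[of Z] by simp
  then have "AE \<omega> in P. \<omega> \<in> Z"
    using Z by (subst P.AE_in_set_eq_1) auto
  moreover have "AE \<omega> in P. emeasure (N \<omega>) D < \<infinity>"
    using prm_AE_finite[OF D] supp by (simp add: D_def)
  ultimately show ?thesis using AE_space
  proof eventually_elim
    case (elim \<omega>)
    then obtain k where k: "emeasure (N \<omega>) (T k) = 0" by (auto simp: Z_def)
    have "AE x in N \<omega>. x \<notin> T k"
      by (rule AE_not_in) (use k T prm_sets[OF elim(3)] in \<open>auto simp: null_sets_def\<close>)
    show ?case
    proof (rule integrableI_bounded_set[where A = D and B = "real k"])
      show "D \<in> sets (N \<omega>)" using D prm_sets[OF elim(3)] by simp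
      show "g \<in> borel_measurable (N \<omega>)" using prm_measurable_cong[OF elim(3), of g] g by simp
      show "emeasure (N \<omega>) D < \<infinity>" by fact
      show "AE x in N \<omega>. x \<in> D \<longrightarrow> norm (g x) \<le> real k"
        using \<open>AE x in N \<omega>. x \<notin> T k\<close> by eventually_elim (auto simp: T_def D_def)
      show "AE x in N \<omega>. x \<notin> D \<longrightarrow> g x = 0"
        using AE_space by eventually_elim (auto simp: D_def prm_space[OF elim(3)])
    qed
  qed
qed

text \<open>
  The exponential formula (Campbell) for Poisson integrals. Simple functions, for which it is the
  independence of the counts on the level sets, approximate \<open>g\<close> from inside its support, so that both
  sides converge by dominated convergence.
\<close>

theorem prm_char_integral:
  fixes g :: "'e \<Rightarrow> real"
  assumes g [measurable]: "g \<in> borel_measurable n" and supp: "emeasure n {x \<in> space n. g x \<noteq> 0} < \<infinity>"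
  shows "(\<integral>\<omega>. iexp (\<integral>x. g x \<partial>N \<omega>) \<partial>P) = exp (\<integral>x. iexp (g x) - 1 \<partial>n)"
proof -
  define D where "D = {x \<in> space n. g x \<noteq> 0}"
  have D [measurable]: "D \<in> sets n" unfolding D_def by measurable
  obtain F where F: "\<And>i. simple_function n (F i)" "\<And>x. x \<in> space n \<Longrightarrow> (\<lambda>i. F i x) \<longlonglongrightarrow> g x"
    and bound: "\<And>i x. x \<in> space n \<Longrightarrow> \<bar>F i x\<bar> \<le> 2 * \<bar>g x\<bar>"
    using borel_measurable_implies_sequence_metric[OF g, of 0] unfolding dist_real_def diff_0_right by blast
  have Fm [measurable]: "F i \<in> borel_measurable n" for i by (rule borel_measurable_simple_function[OF F(1)])
  have F_supp: "emeasure n {x \<in> space n. F i x \<noteq> 0} < \<infinity>" for i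
  proof -
    have "emeasure n {x \<in> space n. F i x \<noteq> 0} \<le> emeasure n D"
      by (rule emeasure_mono) (use bound[of _ i] in \<open>force simp: D_def\<close>)+
    then show ?thesis using supp by (simp add: D_def)
  qed
  note [measurable] = prm_integral_measurable[OF Fm] prm_integral_measurable[OF g]
  have lhs: "(\<lambda>i. \<integral>\<omega>. iexp (\<integral>x. F i x \<partial>N \<omega>) \<partial>P) \<longlonglongrightarrow> (\<integral>\<omega>. iexp (\<integral>x. g x \<partial>N \<omega>) \<partial>P)"
  proof (rule integral_dominated_convergence[where w = "\<lambda>_. 1"])
    from prm_AE_integrable[OF g supp] AE_space
    show "AE \<omega> in P. (\<lambda>i. iexp (\<integral>x. F i x \<partial>N \<omega>)) \<longlonglongrightarrow> iexp (\<integral>x. g x \<partial>N \<omega>)"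
    proof eventually_elim
      case (elim \<omega>)
      have "(\<lambda>i. \<integral>x. F i x \<partial>N \<omega>) \<longlonglongrightarrow> (\<integral>x. g x \<partial>N \<omega>)"
      proof (rule integral_dominated_convergence[where w = "\<lambda>x. 2 * \<bar>g x\<bar>"])
        show "integrable (N \<omega>) (\<lambda>x. 2 * \<bar>g x\<bar>)" using elim by simp
      qed (use elim F(2) bound Fm g in \<open>auto simp: prm_space prm_measurable_cong\<close>)
      then show ?case by (intro tendsto_intros)
    qed
  qed auto
  have "(\<lambda>i. \<integral>x. iexp (F i x) - 1 \<partial>n) \<longlonglongrightarrow> (\<integral>x. iexp (g x) - 1 \<partial>n)"
  proof (rule integral_dominated_convergence[where w = "\<lambda>x. 2 * indicator D x"])
    show "integrable n (\<lambda>x. 2 * indicator D x :: real)"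
      using D supp by (intro integrable_mult_right integrable_real_indicator) (auto simp: D_def)
    show "AE x in n. (\<lambda>i. iexp (F i x) - 1) \<longlonglongrightarrow> iexp (g x) - 1"
      by (intro AE_I2 tendsto_intros F(2))
    show "AE x in n. norm (iexp (F i x) - 1) \<le> 2 * indicator D x" for i
    proof (rule AE_I2)
      fix x assume x: "x \<in> space n"
      show "norm (iexp (F i x) - 1) \<le> 2 * indicator D x"
      proof (cases "x \<in> D")
        case True
        have "norm (iexp (F i x) - 1) \<le> norm (iexp (F i x)) + norm (1::complex)"
          by (rule norm_triangle_ineq4)
        then show ?thesis using True by simp
      next
        case False
        then have "F i x = 0" using bound[OF x, of i] x by (simp add: D_def)
        then show ?thesis by simp
      qed
    qed
  qed auto
  then have rhs: "(\<lambda>i. exp (\<integral>x. iexp (F i x) - 1 \<partial>n)) \<longlonglongrightarrow> exp (\<integral>x. iexp (g x) - 1 \<partial>n)"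
    by (rule tendsto_exp)
  show ?thesis
    by (rule LIMSEQ_unique[OF lhs]) (use rhs in \<open>simp add: prm_char_simple[OF F(1) F_supp]\<close>)
qed

end

section \<open>Finite linear combinations of indicators\<close>

definition step_sum :: "'i set \<Rightarrow> ('i \<Rightarrow> real) \<Rightarrow> ('i \<Rightarrow> 'e set) \<Rightarrow> 'e \<Rightarrow> real" where
  "step_sum J \<theta> A s = (\<Sum>j\<in>J. \<theta> j * indicator (A j) s)"

lemma step_sum_measurable:
  assumes "\<And>j. j \<in> J \<Longrightarrow> A j \<in> sets M"
  shows "step_sum J \<theta> A \<in> borel_measurable M"
  unfolding step_sum_def
  by (intro borel_measurable_sum borel_measurable_times borel_measurable_const borel_measurable_indicator assms)

lemma step_sum_finite_range:
  assumes J: "finite J"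
  shows "finite (step_sum J \<theta> A ` S)"
proof (rule finite_subset)
  show "step_sum J \<theta> A ` S \<subseteq> (\<lambda>K. \<Sum>j\<in>K. \<theta> j) ` Pow J"
  proof
    fix y assume "y \<in> step_sum J \<theta> A ` S"
    then obtain s where "y = step_sum J \<theta> A s" by blast
    also have "\<dots> = (\<Sum>j\<in>J. if s \<in> A j then \<theta> j else 0)"
      unfolding step_sum_def by (intro sum.cong) auto
    also have "\<dots> = (\<Sum>j\<in>{j \<in> J. s \<in> A j}. \<theta> j)"
      using J by (simp add: sum.inter_filter)
    finally show "y \<in> (\<lambda>K. \<Sum>j\<in>K. \<theta> j) ` Pow J" by blast
  qed
  show "finite ((\<lambda>K. \<Sum>j\<in>K. \<theta> j) ` Pow J)" using J by simp
qed

lemma step_sum_support: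
  assumes J: "finite J" and A: "\<And>j. j \<in> J \<Longrightarrow> A j \<in> sets M" "\<And>j. j \<in> J \<Longrightarrow> emeasure M (A j) < \<infinity>"
  shows "emeasure M {s \<in> space M. step_sum J \<theta> A s \<noteq> 0} < \<infinity>"
proof -
  have "\<exists>j\<in>J. s \<in> A j" if "step_sum J \<theta> A s \<noteq> 0" for s
    using sum.not_neutral_contains_not_neutral[OF that[unfolded step_sum_def]] by (auto simp: indicator_def split: if_splits)
  then have "emeasure M {s \<in> space M. step_sum J \<theta> A s \<noteq> 0} \<le> emeasure M (\<Union>j\<in>J. A j)"
    by (intro emeasure_mono sets.finite_UN J A) auto
  also have "\<dots> \<le> (\<Sum>j\<in>J. emeasure M (A j))"
    by (rule emeasure_subadditive_finite[OF J]) (use A in auto)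
  also have "\<dots> < \<infinity>"
    using J A(2) by simp
  finally show ?thesis .
qed

section \<open>Stable random measures\<close>

lemma step_sum_in_L_alpha:
  assumes \<alpha>: "0 < \<alpha>" and J: "finite J"
    and A: "\<And>j. j \<in> J \<Longrightarrow> A j \<in> sets \<kappa>" "\<And>j. j \<in> J \<Longrightarrow> emeasure \<kappa> (A j) < \<infinity>"
  shows "step_sum J \<theta> A \<in> L_alpha \<alpha> \<kappa>"
  using step_sum_measurable[of J A \<kappa> \<theta>] A(1)
    integral_finite_range(1)[OF step_sum_finite_range[OF J] step_sum_measurable[OF A(1)] step_sum_support[OF J A],
      where F = "\<lambda>y. \<bar>y\<bar> powr \<alpha>"] \<alpha>
  by (simp add: L_alpha_def)

lemma indicator_eq_step_sum: "indicator B = step_sum {j} (\<lambda>_. 1) (\<lambda>_. B)"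
  by (rule ext) (simp add: step_sum_def del: sum_mult_indicator)

text \<open>
  Linearity is assumed for two functions and outside a null set that depends on them, so it is extended
  to finite sums by induction.
\<close>

lemma stable_linear_step_sum:
  assumes \<alpha>: "0 < \<alpha>" and W: "stable_random_measure \<alpha> Q \<kappa> W" and J: "finite J"
    and A: "\<And>j. j \<in> J \<Longrightarrow> A j \<in> sets \<kappa>" "\<And>j. j \<in> J \<Longrightarrow> emeasure \<kappa> (A j) < \<infinity>"
  shows "AE \<omega> in Q. W (step_sum J \<theta> A) \<omega> = (\<Sum>j\<in>J. \<theta> j * W (indicator (A j)) \<omega>)"
proof -
  have lin: "AE \<omega> in Q. W (\<lambda>x. a * f x + b * g x) \<omega> = a * W f \<omega> + b * W g \<omega>"
    if "f \<in> L_alpha \<alpha> \<kappa>" "g \<in> L_alpha \<alpha> \<kappa>" for f g a b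
    using W that unfolding stable_random_measure_def by blast
  from J A show ?thesis
  proof (induction J rule: finite_induct)
    case empty
    have "step_sum {} \<theta> A \<in> L_alpha \<alpha> \<kappa>"
      by (rule step_sum_in_L_alpha[OF \<alpha>]) auto
    from lin[OF this this, of 0 0] show ?case
      by (simp add: step_sum_def[abs_def])
  next
    case (insert k K)
    have "step_sum K \<theta> A \<in> L_alpha \<alpha> \<kappa>"
      by (rule step_sum_in_L_alpha[OF \<alpha> insert.hyps(1)]) (use insert.prems in auto)
    moreover have "indicator (A k) \<in> L_alpha \<alpha> \<kappa>"
      unfolding indicator_eq_step_sum[of _ k] by (rule step_sum_in_L_alpha[OF \<alpha>]) (use insert.prems in auto)
    ultimately have "AE \<omega> in Q. W (\<lambda>x. \<theta> k * indicator (A k) x + 1 * step_sum K \<theta> A x) \<omega> =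
        \<theta> k * W (indicator (A k)) \<omega> + 1 * W (step_sum K \<theta> A) \<omega>"
      by (intro lin)
    moreover have "AE \<omega> in Q. W (step_sum K \<theta> A) \<omega> = (\<Sum>j\<in>K. \<theta> j * W (indicator (A j)) \<omega>)"
      using insert by auto
    moreover have "(\<lambda>x. \<theta> k * indicator (A k) x + 1 * step_sum K \<theta> A x) = step_sum (insert k K) \<theta> A"
      using insert.hyps by (simp add: step_sum_def fun_eq_iff del: sum_mult_indicator)
    ultimately show ?case
      using insert.hyps by (auto elim: eventually_elim2)
  qed
qed

lemma stable_char_step_sum:
  assumes \<alpha>: "0 < \<alpha>" and W: "stable_random_measure \<alpha> Q \<kappa> W" and J: "finite J"
    and A: "\<And>j. j \<in> J \<Longrightarrow> A j \<in> sets \<kappa>" "\<And>j. j \<in> J \<Longrightarrow> emeasure \<kappa> (A j) < \<infinity>"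
  shows "(\<integral>\<omega>. iexp (\<Sum>j\<in>J. \<theta> j * W (indicator (A j)) \<omega>) \<partial>Q) =
           exp (of_real (- (\<integral>s. \<bar>step_sum J \<theta> A s\<bar> powr \<alpha> \<partial>\<kappa>)))"
    and "j \<in> J \<Longrightarrow> W (indicator (A j)) \<in> borel_measurable Q"
proof -
  have meas: "W f \<in> borel_measurable Q"
    and law: "is_sas_law \<alpha> ((\<integral>x. \<bar>f x\<bar> powr \<alpha> \<partial>\<kappa>) powr (1 / \<alpha>)) (distr Q borel (W f))"
    if "f \<in> L_alpha \<alpha> \<kappa>" for f
    using W that unfolding stable_random_measure_def by blast+
  have ind: "W (indicator (A j)) \<in> borel_measurable Q" if "j \<in> J" for j
    unfolding indicator_eq_step_sum[of _ j] by (intro meas step_sum_in_L_alpha[OF \<alpha>]) (use A that in auto)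
  then show "j \<in> J \<Longrightarrow> W (indicator (A j)) \<in> borel_measurable Q" .
  define f where "f = step_sum J \<theta> A"
  have f: "f \<in> L_alpha \<alpha> \<kappa>" unfolding f_def by (rule step_sum_in_L_alpha[OF \<alpha> J A])
  note [measurable] = meas[OF f] ind
  have "(\<integral>\<omega>. iexp (\<Sum>j\<in>J. \<theta> j * W (indicator (A j)) \<omega>) \<partial>Q) = (\<integral>\<omega>. iexp (W f \<omega>) \<partial>Q)"
  proof (rule integral_cong_AE)
    show "AE \<omega> in Q. iexp (\<Sum>j\<in>J. \<theta> j * W (indicator (A j)) \<omega>) = iexp (W f \<omega>)"
    proof -
      have "AE \<omega> in Q. W f \<omega> = (\<Sum>j\<in>J. \<theta> j * W (indicator (A j)) \<omega>)"
        unfolding f_def by (rule stable_linear_step_sum[OF \<alpha> W J A])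
      then show ?thesis by eventually_elim simp
    qed
  qed measurable
  also have "\<dots> = char (distr Q borel (W f)) 1"
    by (simp add: char_def integral_distr)
  also have "\<dots> = of_real (exp (- (((\<integral>x. \<bar>f x\<bar> powr \<alpha> \<partial>\<kappa>) powr (1 / \<alpha>)) powr \<alpha>)))"
    using law[OF f] by (simp add: is_sas_law_def)
  also have "((\<integral>x. \<bar>f x\<bar> powr \<alpha> \<partial>\<kappa>) powr (1 / \<alpha>)) powr \<alpha> = (\<integral>x. \<bar>f x\<bar> powr \<alpha> \<partial>\<kappa>)"
    using \<alpha> by (simp add: powr_powr)
  finally show "(\<integral>\<omega>. iexp (\<Sum>j\<in>J. \<theta> j * W (indicator (A j)) \<omega>) \<partial>Q) =
           exp (of_real (- (\<integral>s. \<bar>step_sum J \<theta> A s\<bar> powr \<alpha> \<partial>\<kappa>)))"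
    by (simp add: f_def exp_of_real flip: of_real_minus)
qed

section \<open>Compound Poisson sums over sets\<close>

lemma scale_measure_eq_density:
  "scale_measure c M = density M (\<lambda>_. c)"
  by (rule measure_eqI) (simp_all add: emeasure_density nn_integral_cmult_indicator)

lemma integral_scale_measure:
  fixes f :: "'a \<Rightarrow> 'b :: {banach, second_countable_topology}"
  assumes "0 \<le> l" "f \<in> borel_measurable M"
  shows "(\<integral>x. f x \<partial>scale_measure (ennreal l) M) = l *\<^sub>R (\<integral>x. f x \<partial>M)"
  unfolding scale_measure_eq_density using assms by (simp add: integral_density)

text \<open>
  By linearity the sum is a single Poisson integral of \<open>\<xi> * f s\<close>, and Fubini carries out the integration
  over the mark \<open>\<xi>\<close>, which produces the characteristic function of \<open>G\<close>.
\<close>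

lemma compound_char:
  assumes l: "0 < l" and prm: "poisson_random_measure P (scale_measure (ennreal l) (\<kappa> \<Otimes>\<^sub>M G)) N"
    and \<kappa>: "sigma_finite_measure \<kappa>" and G: "real_distribution G" and J: "finite J"
    and A: "\<And>j. j \<in> J \<Longrightarrow> A j \<in> sets \<kappa>" "\<And>j. j \<in> J \<Longrightarrow> emeasure \<kappa> (A j) < \<infinity>"
  shows "(\<integral>\<omega>. iexp (\<Sum>j\<in>J. \<theta> j * (\<integral>(s, \<xi>). \<xi> * indicator (A j) s \<partial>N \<omega>)) \<partial>P) =
           exp (of_real l * (\<integral>s. char G (step_sum J \<theta> A s) - 1 \<partial>\<kappa>))"
    and "j \<in> J \<Longrightarrow> (\<lambda>\<omega>. \<integral>(s, \<xi>). \<xi> * indicator (A j) s \<partial>N \<omega>) \<in> borel_measurable P"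
proof -
  interpret \<kappa>: sigma_finite_measure \<kappa> by fact
  interpret G: real_distribution G by fact
  interpret pair_sigma_finite \<kappa> G by standard
  let ?n = "scale_measure (ennreal l) (\<kappa> \<Otimes>\<^sub>M G)"
  define f where "f = step_sum J \<theta> A"
  have [measurable]: "f \<in> borel_measurable \<kappa>" unfolding f_def by (rule step_sum_measurable[OF A(1)])
  have supp_f: "emeasure \<kappa> {s \<in> space \<kappa>. f s \<noteq> 0} < \<infinity>" unfolding f_def by (rule step_sum_support[OF J A])
  have [measurable]: "snd \<in> borel_measurable (\<kappa> \<Otimes>\<^sub>M G)"
    using measurable_snd[of \<kappa> G] by (simp cong: measurable_cong_sets)
  have supp: "emeasure ?n {x \<in> space ?n. snd x * h (fst x) \<noteq> 0} < \<infinity>"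
    if [measurable]: "h \<in> borel_measurable \<kappa>" and h: "emeasure \<kappa> {s \<in> space \<kappa>. h s \<noteq> 0} < \<infinity>" for h :: "_ \<Rightarrow> real"
  proof -
    have "emeasure (\<kappa> \<Otimes>\<^sub>M G) {x \<in> space ?n. snd x * h (fst x) \<noteq> 0} \<le>
        emeasure (\<kappa> \<Otimes>\<^sub>M G) ({s \<in> space \<kappa>. h s \<noteq> 0} \<times> space G)"
      by (rule emeasure_mono) (auto simp: space_scale_measure space_pair_measure)
    also have "\<dots> = emeasure \<kappa> {s \<in> space \<kappa>. h s \<noteq> 0} * emeasure G (space G)"
      by (rule G.emeasure_pair_measure_Times) auto
    also have "\<dots> < \<infinity>" using h by (simp only: G.emeasure_space_1) simp
    finally show ?thesis
      by (simp add: ennreal_mult_less_top)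
  qed
  have meas: "(\<lambda>x. snd x * h (fst x)) \<in> borel_measurable ?n" if [measurable]: "h \<in> borel_measurable \<kappa>" for h :: "_ \<Rightarrow> real"
    by measurable
  have ind: "indicator (A j) \<in> borel_measurable \<kappa>" "emeasure \<kappa> {s \<in> space \<kappa>. indicator (A j) s \<noteq> (0::real)} < \<infinity>"
    if "j \<in> J" for j
  proof -
    have "{s \<in> space \<kappa>. indicator (A j) s \<noteq> (0::real)} = A j"
      using sets.sets_into_space[OF A(1)[OF that]] by (auto simp: indicator_def)
    then show "indicator (A j) \<in> borel_measurable \<kappa>" "emeasure \<kappa> {s \<in> space \<kappa>. indicator (A j) s \<noteq> (0::real)} < \<infinity>"
      using A that by auto
  qed
  have int_meas: "(\<lambda>\<omega>. \<integral>(s, \<xi>). \<xi> * indicator (A j) s \<partial>N \<omega>) \<in> borel_measurable P" if "j \<in> J" for j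
    using prm_integral_measurable[OF prm meas[OF ind(1)[OF that]]] by (simp add: split_beta')
  then show "j \<in> J \<Longrightarrow> (\<lambda>\<omega>. \<integral>(s, \<xi>). \<xi> * indicator (A j) s \<partial>N \<omega>) \<in> borel_measurable P" .
  have "(\<integral>\<omega>. iexp (\<Sum>j\<in>J. \<theta> j * (\<integral>(s, \<xi>). \<xi> * indicator (A j) s \<partial>N \<omega>)) \<partial>P) = (\<integral>\<omega>. iexp (\<integral>x. snd x * f (fst x) \<partial>N \<omega>) \<partial>P)"
  proof (rule integral_cong_AE)
    note [measurable] = int_meas prm_integral_measurable[OF prm meas[of f]]
    show "(\<lambda>\<omega>. iexp (\<Sum>j\<in>J. \<theta> j * (\<integral>(s, \<xi>). \<xi> * indicator (A j) s \<partial>N \<omega>))) \<in> borel_measurable P"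
      by measurable
    show "(\<lambda>\<omega>. iexp (\<integral>x. snd x * f (fst x) \<partial>N \<omega>)) \<in> borel_measurable P"
      by measurable
    have "AE \<omega> in P. \<forall>j\<in>J. integrable (N \<omega>) (\<lambda>x. snd x * indicator (A j) (fst x) :: real)"
      using J ind by (intro AE_finite_allI prm_AE_integrable[OF prm meas supp])
    then show "AE \<omega> in P. iexp (\<Sum>j\<in>J. \<theta> j * (\<integral>(s, \<xi>). \<xi> * indicator (A j) s \<partial>N \<omega>)) = iexp (\<integral>x. snd x * f (fst x) \<partial>N \<omega>)"
    proof eventually_elim
      case (elim \<omega>)
      have "(\<integral>x. snd x * f (fst x) \<partial>N \<omega>) = (\<integral>x. (\<Sum>j\<in>J. \<theta> j * (snd x * indicator (A j) (fst x))) \<partial>N \<omega>)"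
        by (simp add: f_def step_sum_def sum_distrib_left mult_ac)
      also have "\<dots> = (\<Sum>j\<in>J. \<theta> j * (\<integral>x. snd x * indicator (A j) (fst x) \<partial>N \<omega>))"
        using elim by (subst Bochner_Integration.integral_sum) auto
      finally show ?case by (simp add: split_beta')
    qed
  qed
  also have "\<dots> = exp (\<integral>x. iexp (snd x * f (fst x)) - 1 \<partial>?n)"
    by (rule prm_char_integral[OF prm meas supp]) (use supp_f in auto)
  also have "(\<integral>x. iexp (snd x * f (fst x)) - 1 \<partial>?n) = of_real l * (\<integral>x. iexp (snd x * f (fst x)) - 1 \<partial>(\<kappa> \<Otimes>\<^sub>M G))"
    using l by (subst integral_scale_measure) (auto simp: scaleR_conv_of_real)
  also have "(\<integral>x. iexp (snd x * f (fst x)) - 1 \<partial>(\<kappa> \<Otimes>\<^sub>M G)) = (\<integral>s. (\<integral>\<xi>. iexp (snd (s, \<xi>) * f (fst (s, \<xi>))) - 1 \<partial>G) \<partial>\<kappa>)"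
  proof (rule integral_fst'[symmetric])
    define D where "D = {s \<in> space \<kappa>. f s \<noteq> 0} \<times> space G"
    have D: "D \<in> sets (\<kappa> \<Otimes>\<^sub>M G)" unfolding D_def by measurable
    have "emeasure (\<kappa> \<Otimes>\<^sub>M G) D = emeasure \<kappa> {s \<in> space \<kappa>. f s \<noteq> 0} * emeasure G (space G)"
      unfolding D_def by (rule G.emeasure_pair_measure_Times) auto
    then have D_fin: "emeasure (\<kappa> \<Otimes>\<^sub>M G) D < \<infinity>" using supp_f by (simp only: G.emeasure_space_1) simp
    show "integrable (\<kappa> \<Otimes>\<^sub>M G) (\<lambda>x. iexp (snd x * f (fst x)) - 1)"
    proof (rule integrableI_bounded_set[OF D _ D_fin AE_I2 AE_I2, where B = 2])
      show "x \<in> D \<longrightarrow> norm (iexp (snd x * f (fst x)) - 1) \<le> 2" for x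
        using norm_triangle_ineq4[of "iexp (snd x * f (fst x))" 1] by simp
      show "x \<notin> D \<longrightarrow> iexp (snd x * f (fst x)) - 1 = 0" if "x \<in> space (\<kappa> \<Otimes>\<^sub>M G)" for x
        using that by (auto simp: D_def space_pair_measure)
    qed measurable
  qed
  also have "\<dots> = (\<integral>s. char G (f s) - 1 \<partial>\<kappa>)"
  proof (rule Bochner_Integration.integral_cong[OF refl])
    fix s
    have "integrable G (\<lambda>\<xi>. iexp (\<xi> * f s))" by (intro G.integrable_iexp) auto
    then have "(\<integral>\<xi>. iexp (\<xi> * f s) - 1 \<partial>G) = (\<integral>\<xi>. iexp (\<xi> * f s) \<partial>G) - 1"
      using G.prob_space by simp
    then show "(\<integral>\<xi>. iexp (snd (s, \<xi>) * f (fst (s, \<xi>))) - 1 \<partial>G) = char G (f s) - 1"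
      by (simp add: char_def mult.commute)
  qed
  finally show "(\<integral>\<omega>. iexp (\<Sum>j\<in>J. \<theta> j * (\<integral>(s, \<xi>). \<xi> * indicator (A j) s \<partial>N \<omega>)) \<partial>P) =
           exp (of_real l * (\<integral>s. char G (step_sum J \<theta> A s) - 1 \<partial>\<kappa>))"
    by (simp add: f_def)
qed

lemma compound_exponent_tendsto:
  assumes \<alpha>: "0 < \<alpha>" and \<sigma>: "0 < \<sigma>" and nda: "normal_domain_of_attraction \<alpha> \<sigma> G" and J: "finite J"
    and A: "\<And>j. j \<in> J \<Longrightarrow> A j \<in> sets \<kappa>" "\<And>j. j \<in> J \<Longrightarrow> emeasure \<kappa> (A j) < \<infinity>"
  shows "((\<lambda>l. of_real l * (\<integral>s. char G (step_sum J (\<lambda>j. inverse \<sigma> * l powr (- 1 / \<alpha>) * \<theta> j) A s) - 1 \<partial>\<kappa>)) \<longlongrightarrow>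
           of_real (- (\<integral>s. \<bar>step_sum J \<theta> A s\<bar> powr \<alpha> \<partial>\<kappa>))) at_top"
proof -
  interpret G: real_distribution G by (rule domain_of_attraction_distr[OF \<alpha> nda])
  define f where "f = step_sum J \<theta> A"
  define Y where "Y = f ` space \<kappa> - {0}"
  define S where "S y = measure \<kappa> {s \<in> space \<kappa>. f s = y}" for y
  have range_complex: "(\<integral>s. F (f s) \<partial>\<kappa>) = (\<Sum>y\<in>Y. S y *\<^sub>R F y)" if "F 0 = 0" for F :: "real \<Rightarrow> complex"
    unfolding Y_def S_def f_def
    by (rule integral_finite_range(2)[where F = F, OF step_sum_finite_range[OF J] step_sum_measurable[OF A(1)] step_sum_support[OF J A] that])
  have range_real: "(\<integral>s. F (f s) \<partial>\<kappa>) = (\<Sum>y\<in>Y. S y *\<^sub>R F y)" if "F 0 = 0" for F :: "real \<Rightarrow> real"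
    unfolding Y_def S_def f_def
    by (rule integral_finite_range(2)[where F = F, OF step_sum_finite_range[OF J] step_sum_measurable[OF A(1)] step_sum_support[OF J A] that])
  have scale: "step_sum J (\<lambda>j. b * \<theta> j) A s = b * f s" for b s
    by (simp add: f_def step_sum_def sum_distrib_left mult_ac)
  have "of_real l * (\<integral>s. char G (inverse \<sigma> * l powr (- 1 / \<alpha>) * f s) - 1 \<partial>\<kappa>) =
      (\<Sum>y\<in>Y. S y *\<^sub>R (of_real l * (char G (inverse \<sigma> * y * l powr (- 1 / \<alpha>)) - 1)))" for l
    by (subst range_complex[of "\<lambda>y. char G (inverse \<sigma> * l powr (- 1 / \<alpha>) * y) - 1"])
      (simp_all add: G.char_zero sum_distrib_left mult_ac)
  moreover have "of_real (- (\<integral>s. \<bar>f s\<bar> powr \<alpha> \<partial>\<kappa>)) =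
      (\<Sum>y\<in>Y. S y *\<^sub>R complex_of_real (- (\<sigma> powr \<alpha> * \<bar>inverse \<sigma> * y\<bar> powr \<alpha>)))"
  proof -
    have "\<sigma> powr \<alpha> * \<bar>inverse \<sigma> * y\<bar> powr \<alpha> = \<bar>y\<bar> powr \<alpha>" for y
      using \<sigma> by (simp add: abs_mult powr_mult inverse_eq_divide powr_divide)
    then show ?thesis
      using \<alpha> by (subst range_real[of "\<lambda>y. \<bar>y\<bar> powr \<alpha>"]) (simp_all add: sum_negf scaleR_conv_of_real)
  qed
  ultimately show ?thesis
    unfolding scale f_def[symmetric]
    by (simp only:) (intro tendsto_sum tendsto_scaleR tendsto_const scaled_char_minus_1_tendsto[OF \<alpha> nda])
qed

text \<open>
  The common form of both parts: \<open>c\<close> is \<open>sqrt pi\<close> on the sphere and \<open>1\<close> in Euclidean space, and it is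
  absorbed into the weights \<open>\<theta> j\<close> of a linear combination. The continuity theorem is about sequences,
  so the limit \<open>l \<rightarrow> \<infinity>\<close> is taken along an arbitrary sequence.
\<close>

theorem poisson_sums_fdd_converge_to_stable:
  fixes A :: "'i \<Rightarrow> 'e set" and c :: real
  assumes \<alpha>: "0 < \<alpha>" and \<sigma>: "0 < \<sigma>" and nda: "normal_domain_of_attraction \<alpha> \<sigma> G"
    and \<kappa>: "sigma_finite_measure \<kappa>"
    and A: "\<And>m. m \<in> T \<Longrightarrow> A m \<in> sets \<kappa>" "\<And>m. m \<in> T \<Longrightarrow> emeasure \<kappa> (A m) < \<infinity>"
    and prm: "\<And>l. 0 < l \<Longrightarrow> poisson_random_measure (P l) (scale_measure (ennreal l) (\<kappa> \<Otimes>\<^sub>M G)) (N l)"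
    and W: "stable_random_measure \<alpha> Q \<kappa> W"
  shows "fdd_converges T
      P (\<lambda>l m \<omega>. c * inverse \<sigma> * l powr (- 1 / \<alpha>) * (\<integral>(s, \<xi>). \<xi> * indicator (A m) s \<partial>N l \<omega>))
      Q (\<lambda>m \<omega>. c * W (indicator (A m)) \<omega>) at_top"
  unfolding fdd_converges_def
proof (intro allI impI, elim conjE)
  fix J assume J: "finite J" and JT: "J \<subseteq> T"
  note G = domain_of_attraction_distr[OF \<alpha> nda]
  have AJ: "\<And>j. j \<in> J \<Longrightarrow> A j \<in> sets \<kappa>" "\<And>j. j \<in> J \<Longrightarrow> emeasure \<kappa> (A j) < \<infinity>"
    using A JT by auto
  define X where "X l m \<omega> = c * inverse \<sigma> * l powr (- 1 / \<alpha>) * (\<integral>(s, \<xi>). \<xi> * indicator (A m) s \<partial>N l \<omega>)" for l m \<omega>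
  define Z where "Z m \<omega> = c * W (indicator (A m)) \<omega>" for m \<omega>
  interpret Q: prob_space Q using W by (simp add: stable_random_measure_def)
  have P: "prob_space (P l)" if "0 < l" for l
    using prm[OF that] by (simp add: poisson_random_measure_def)
  have Xm: "X l j \<in> borel_measurable (P l)" if "0 < l" "j \<in> J" for l j
    unfolding X_def by (intro borel_measurable_times borel_measurable_const compound_char(2)[OF that(1) prm[OF that(1)] \<kappa> G J AJ that(2)])
  have Zm: "Z j \<in> borel_measurable Q" if "j \<in> J" for j
    unfolding Z_def by (intro borel_measurable_times borel_measurable_const stable_char_step_sum(2)[OF \<alpha> W J AJ that])
  have fdl: "prob_space (fin_dim_law M V J)"
      "(\<integral>x. iexp (\<Sum>j\<in>J. \<theta> j * x j) \<partial>fin_dim_law M V J) = (\<integral>\<omega>. iexp (\<Sum>j\<in>J. \<theta> j * V j \<omega>) \<partial>M)"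
    if "prob_space M" and [measurable]: "\<And>j. j \<in> J \<Longrightarrow> V j \<in> borel_measurable M" for M V \<theta>
  proof -
    have m: "(\<lambda>\<omega>. \<lambda>j\<in>J. V j \<omega>) \<in> M \<rightarrow>\<^sub>M Pi\<^sub>M J (\<lambda>_. borel)"
      by (rule measurable_restrict) fact
    show "prob_space (fin_dim_law M V J)"
      unfolding fin_dim_law_def by (rule prob_space.prob_space_distr[OF that(1) m])
    show "(\<integral>x. iexp (\<Sum>j\<in>J. \<theta> j * x j) \<partial>fin_dim_law M V J) = (\<integral>\<omega>. iexp (\<Sum>j\<in>J. \<theta> j * V j \<omega>) \<partial>M)"
      unfolding fin_dim_law_def by (subst integral_distr[OF m]) (simp_all cong: sum.cong)
  qed
  have char_conv: "((\<lambda>l. \<integral>\<omega>. iexp (\<Sum>j\<in>J. \<theta> j * X l j \<omega>) \<partial>P l) \<longlongrightarrow> (\<integral>\<omega>. iexp (\<Sum>j\<in>J. \<theta> j * Z j \<omega>) \<partial>Q)) at_top" for \<theta>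
  proof -
    define b where "b l j = inverse \<sigma> * l powr (- 1 / \<alpha>) * (\<theta> j * c)" for l j
    have lim: "((\<lambda>l. exp (of_real l * (\<integral>s. char G (step_sum J (b l) A s) - 1 \<partial>\<kappa>))) \<longlongrightarrow>
        exp (of_real (- (\<integral>s. \<bar>step_sum J (\<lambda>j. \<theta> j * c) A s\<bar> powr \<alpha> \<partial>\<kappa>)))) at_top"
      unfolding b_def by (intro tendsto_exp compound_exponent_tendsto[OF \<alpha> \<sigma> nda J AJ])
    have ev: "\<forall>\<^sub>F l in at_top. exp (of_real l * (\<integral>s. char G (step_sum J (b l) A s) - 1 \<partial>\<kappa>)) =
        (\<integral>\<omega>. iexp (\<Sum>j\<in>J. \<theta> j * X l j \<omega>) \<partial>P l)"
      using eventually_gt_at_top[of 0]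
    proof eventually_elim
      case (elim l)
      have "\<theta> j * X l j \<omega> = b l j * (\<integral>(s, \<xi>). \<xi> * indicator (A j) s \<partial>N l \<omega>)" for j \<omega>
        by (simp add: X_def b_def)
      then show ?case
        by (simp only: compound_char(1)[OF elim prm[OF elim] \<kappa> G J AJ])
    qed
    have "\<theta> j * Z j \<omega> = (\<theta> j * c) * W (indicator (A j)) \<omega>" for j \<omega>
      by (simp add: Z_def)
    then have "(\<integral>\<omega>. iexp (\<Sum>j\<in>J. \<theta> j * Z j \<omega>) \<partial>Q) = exp (of_real (- (\<integral>s. \<bar>step_sum J (\<lambda>j. \<theta> j * c) A s\<bar> powr \<alpha> \<partial>\<kappa>)))"
      by (simp only: stable_char_step_sum(1)[OF \<alpha> W J AJ])
    with Lim_transform_eventually[OF lim ev] show ?thesis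
      by (simp only:)
  qed
  show "weakly_converges (product_topology (\<lambda>_. euclideanreal) J) (\<lambda>l. fin_dim_law (P l) (X l) J) (fin_dim_law Q Z J) at_top"
    unfolding weakly_converges_def
  proof (intro allI impI tendsto_at_topI_sequentially)
    fix \<phi> and l :: "nat \<Rightarrow> real"
    assume \<phi>: "continuous_map (product_topology (\<lambda>_. euclideanreal) J) euclideanreal \<phi> \<and>
        bounded (\<phi> ` topspace (product_topology (\<lambda>_. euclideanreal) J))"
      and l: "filterlim l at_top sequentially"
    \<comment> \<open>Positive along the whole sequence, and eventually equal to \<open>l\<close>.\<close>
    define l' where "l' k = max 1 (l k)" for k
    have l'_pos: "0 < l' k" for k by (simp add: l'_def)
    have ev: "\<forall>\<^sub>F k in sequentially. l' k = l k"
      using filterlim_at_top[THEN iffD1, OF l, rule_format, of 1] by eventually_elim (simp add: l'_def)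
    have l': "filterlim l' at_top sequentially"
      using filterlim_cong[OF refl refl ev] l by blast
    have "weakly_converges (product_topology (\<lambda>_. euclideanreal) J)
        (\<lambda>k. fin_dim_law (P (l' k)) (X (l' k)) J) (fin_dim_law Q Z J) sequentially"
    proof (rule levy_continuity_PiM[OF J])
      show "prob_space (fin_dim_law (P (l' k)) (X (l' k)) J)" for k
        by (intro fdl P Xm l'_pos)
      show "prob_space (fin_dim_law Q Z J)"
        by (intro fdl Zm Q.prob_space_axioms)
      show "(\<lambda>k. \<integral>x. iexp (\<Sum>j\<in>J. \<theta> j * x j) \<partial>fin_dim_law (P (l' k)) (X (l' k)) J) \<longlonglongrightarrow>
          (\<integral>x. iexp (\<Sum>j\<in>J. \<theta> j * x j) \<partial>fin_dim_law Q Z J)" for \<theta>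
        using filterlim_compose[OF char_conv l']
        by (simp only: fdl(2)[OF P[OF l'_pos] Xm[OF l'_pos]] fdl(2)[OF Q.prob_space_axioms Zm])
    qed (simp_all add: fin_dim_law_def)
    then have "(\<lambda>k. \<integral>x. \<phi> x \<partial>fin_dim_law (P (l' k)) (X (l' k)) J) \<longlonglongrightarrow> (\<integral>x. \<phi> x \<partial>fin_dim_law Q Z J)"
      using \<phi> unfolding weakly_converges_def by blast
    then show "(\<lambda>k. \<integral>x. \<phi> x \<partial>fin_dim_law (P (l k)) (X (l k)) J) \<longlonglongrightarrow> (\<integral>x. \<phi> x \<partial>fin_dim_law Q Z J)"
      by (rule Lim_transform_eventually) (use ev in eventually_elim, simp)
  qed
qed

section \<open>Hemispheres and half-spaces\<close>

text \<open>
  The arccosine is antitone on \<open>[-1, 1]\<close>, so a hemisphere is cut out of the sphere by a closed half-space.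
\<close>

lemma hemisphere_sets:
  assumes "m \<in> sphere 0 1"
  shows "hemisphere m \<in> sets sphere_measure"
proof -
  have "hemisphere m = {x. 0 \<le> m \<bullet> x} \<inter> sphere 0 1"
  proof -
    have "arccos (m \<bullet> x) \<le> pi / 2 \<longleftrightarrow> 0 \<le> m \<bullet> x" if "x \<in> sphere 0 1" for x
    proof -
      have "\<bar>m \<bullet> x\<bar> \<le> 1"
        using Cauchy_Schwarz_ineq2[of m x] assms that by simp
      then show ?thesis
        using arccos_le_mono[of "m \<bullet> x" 0] by simp
    qed
    then show ?thesis by (auto simp: hemisphere_def geodesic_dist_def)
  qed
  moreover have "{x. 0 \<le> m \<bullet> x} \<in> sets borel" by measurable
  ultimately show ?thesis
    unfolding sphere_measure_def sets_restrict_space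
    by (intro image_eqI[of _ _ "{x. 0 \<le> m \<bullet> x}"]) (simp_all add: Int_commute)
qed

lemma hemisphere_diff_sets:
  "p \<in> sphere 0 1 \<Longrightarrow> m \<in> sphere 0 1 \<Longrightarrow> hemisphere_diff p m \<in> sets sphere_measure"
  unfolding hemisphere_diff_def by (intro sets.Un sets.Diff hemisphere_sets)

lemma space_sphere_measure: "space sphere_measure = sphere 0 1"
  by (simp add: sphere_measure_def space_restrict_space)

lemma
  fixes m :: "'a :: euclidean_space"
  shows V_set_sets: "V_set m \<in> sets hyperplane_measure"
    and V_set_finite: "emeasure hyperplane_measure (V_set m) < \<infinity>"
proof -
  let ?R = "restrict_space lborel {0::real<..}"
  interpret R: sigma_finite_measure ?R
    by (rule sigma_finite_measure_restrict_space[OF lborel.sigma_finite_measure_axioms]) simp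
  interpret S: prob_space "sphere_measure :: 'a measure" by (rule prob_space_sphere_measure)
  have [measurable]: "(\<lambda>s. s \<bullet> m) \<in> borel_measurable sphere_measure"
    unfolding sphere_measure_def by (rule measurable_restrict_space1) simp
  have [measurable]: "(\<lambda>r. r) \<in> borel_measurable ?R"
    by (rule measurable_restrict_space1) simp
  have eq: "V_set m = {x \<in> space hyperplane_measure. snd x < fst x \<bullet> m}"
    by (auto simp: V_set_def hyperplane_measure_def space_pair_measure space_sphere_measure space_restrict_space)
  show "V_set m \<in> sets hyperplane_measure"
    unfolding eq unfolding hyperplane_measure_def by measurable
  have I: "{0<..norm m} \<in> sets ?R"
    by (subst sets_restrict_space_iff) auto
  \<comment> \<open>By Cauchy-Schwarz the height \<open>s \<bullet> m\<close> is at most \<open>norm m\<close>.\<close>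
  have "V_set m \<subseteq> space sphere_measure \<times> {0<..norm m}"
  proof
    fix x assume "x \<in> V_set m"
    then obtain s r where x: "x = (s, r)" "s \<in> sphere 0 1" "0 < r" "r < s \<bullet> m" by (auto simp: V_set_def)
    then show "x \<in> space sphere_measure \<times> {0<..norm m}"
      using norm_cauchy_schwarz[of s m] by (simp add: space_sphere_measure)
  qed
  moreover have "space sphere_measure \<times> {0<..norm m} \<in> sets (hyperplane_measure :: ('a \<times> real) measure)"
    unfolding hyperplane_measure_def using I by (intro pair_measureI sets.top)
  ultimately have "emeasure hyperplane_measure (V_set m) \<le>
      emeasure hyperplane_measure (space (sphere_measure :: 'a measure) \<times> {0<..norm m})"
    by (rule emeasure_mono)
  also have "\<dots> = emeasure sphere_measure (space (sphere_measure :: 'a measure)) * emeasure ?R {0<..norm m}"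
    unfolding hyperplane_measure_def by (rule R.emeasure_pair_measure_Times) (use I in auto)
  also have "\<dots> = emeasure lborel {0<..norm m}"
    by (subst emeasure_restrict_space) (auto simp: S.emeasure_space_1)
  also have "\<dots> < \<infinity>" by simp
  finally show "emeasure hyperplane_measure (V_set m) < \<infinity>" .
qed

lemma sigma_finite_hyperplane_measure: "sigma_finite_measure hyperplane_measure"
  unfolding hyperplane_measure_def
  by (rule sigma_finite_pair_measure[OF prob_space_imp_sigma_finite[OF prob_space_sphere_measure]
        sigma_finite_measure_restrict_space[OF lborel.sigma_finite_measure_axioms]]) simp

theorem theorem4p2:
  fixes \<alpha> \<sigma> :: real and q :: nat and G :: "real measure"
    and pole :: "real ^ 'p"
    and P1 :: "real \<Rightarrow> 'w1 measure" and N1 :: "real \<Rightarrow> 'w1 \<Rightarrow> ((real ^ 'p) \<times> real) measure"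
    and Q1 :: "'v1 measure" and W1 :: "((real ^ 'p) \<Rightarrow> real) \<Rightarrow> 'v1 \<Rightarrow> real"
    and P2 :: "real \<Rightarrow> 'w2 measure" and N2 :: "real \<Rightarrow> 'w2 \<Rightarrow> (((real ^ 'q) \<times> real) \<times> real) measure"
    and Q2 :: "'v2 measure" and W2 :: "((real ^ 'q) \<times> real \<Rightarrow> real) \<Rightarrow> 'v2 \<Rightarrow> real"
  assumes "0 < \<alpha>" and "\<alpha> \<le> 2"
    and "q \<ge> 1" and "CARD('q) = q" and "CARD('p) = q + 1"
    and "\<sigma> > 0" and "normal_domain_of_attraction \<alpha> \<sigma> G"
  shows
    "(pole \<in> sphere 0 1 \<and>
      (\<forall>l>0. poisson_random_measure (P1 l)
               (scale_measure (ennreal l) (sphere_measure \<Otimes>\<^sub>M G)) (N1 l)) \<and>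
      stable_random_measure \<alpha> Q1 sphere_measure W1
      \<longrightarrow>
      fdd_converges (sphere 0 1)
        P1 (\<lambda>l m \<omega>. sqrt pi * inverse \<sigma> * l powr (- 1 / \<alpha>) *
              (\<integral>(s, \<xi>). \<xi> * indicator (hemisphere_diff pole m) s \<partial>N1 l \<omega>))
        Q1 (levy_motion_sphere pole W1)
        at_top) \<and>
     ((\<forall>l>0. poisson_random_measure (P2 l)
               (scale_measure (ennreal l) (hyperplane_measure \<Otimes>\<^sub>M G)) (N2 l)) \<and>
      stable_random_measure \<alpha> Q2 hyperplane_measure W2
      \<longrightarrow>
      fdd_converges UNIV
        P2 (\<lambda>l m \<omega>. inverse \<sigma> * l powr (- 1 / \<alpha>) *
              (\<integral>((s, r), \<xi>). \<xi> * indicator (V_set m) (s, r) \<partial>N2 l \<omega>))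
        Q2 (levy_motion_euclidean W2)
        at_top)"
proof (intro conjI impI)
  note core = poisson_sums_fdd_converge_to_stable[OF \<open>0 < \<alpha>\<close> \<open>\<sigma> > 0\<close> \<open>normal_domain_of_attraction \<alpha> \<sigma> G\<close>]
  assume *: "pole \<in> sphere 0 1 \<and>
      (\<forall>l>0. poisson_random_measure (P1 l)
               (scale_measure (ennreal l) (sphere_measure \<Otimes>\<^sub>M G)) (N1 l)) \<and>
      stable_random_measure \<alpha> Q1 sphere_measure W1"
  interpret S: prob_space "sphere_measure :: (real ^ 'p) measure"
    by (rule prob_space_sphere_measure)
  show "fdd_converges (sphere 0 1)
        P1 (\<lambda>l m \<omega>. sqrt pi * inverse \<sigma> * l powr (- 1 / \<alpha>) *
              (\<integral>(s, \<xi>). \<xi> * indicator (hemisphere_diff pole m) s \<partial>N1 l \<omega>))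
        Q1 (levy_motion_sphere pole W1) at_top"
    unfolding levy_motion_sphere_def[abs_def]
  proof (rule core)
    show "sigma_finite_measure (sphere_measure :: (real ^ 'p) measure)"
      by (rule S.sigma_finite_measure_axioms)
    show "hemisphere_diff pole m \<in> sets sphere_measure" if "m \<in> sphere 0 1" for m
      using * that by (intro hemisphere_diff_sets) auto
    show "emeasure sphere_measure (hemisphere_diff pole m) < \<infinity>" for m
      by (simp add: S.emeasure_eq_measure)
  qed (use * in auto)
next
  note core = poisson_sums_fdd_converge_to_stable[OF \<open>0 < \<alpha>\<close> \<open>\<sigma> > 0\<close> \<open>normal_domain_of_attraction \<alpha> \<sigma> G\<close>
      sigma_finite_hyperplane_measure, of UNIV V_set P2 N2 Q2 W2 1]
  assume "(\<forall>l>0. poisson_random_measure (P2 l)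
               (scale_measure (ennreal l) (hyperplane_measure \<Otimes>\<^sub>M G)) (N2 l)) \<and>
      stable_random_measure \<alpha> Q2 hyperplane_measure W2"
  then have "fdd_converges UNIV
      P2 (\<lambda>l m \<omega>. 1 * inverse \<sigma> * l powr (- 1 / \<alpha>) * (\<integral>(s, \<xi>). \<xi> * indicator (V_set m) s \<partial>N2 l \<omega>))
      Q2 (\<lambda>m \<omega>. 1 * W2 (indicator (V_set m)) \<omega>) at_top"
    by (intro core V_set_sets V_set_finite) auto
  moreover have "(\<lambda>((s, r), \<xi>). \<xi> * indicator (V_set m) (s, r)) = (\<lambda>(s, \<xi>). \<xi> * indicator (V_set m) s :: real)"
    for m :: "real ^ 'q"
    by auto
  ultimately show "fdd_converges UNIV
        P2 (\<lambda>l m \<omega>. inverse \<sigma> * l powr (- 1 / \<alpha>) *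
              (\<integral>((s, r), \<xi>). \<xi> * indicator (V_set m) (s, r) \<partial>N2 l \<omega>))
        Q2 (levy_motion_euclidean W2) at_top"
    by (simp only: levy_motion_euclidean_def[abs_def] mult_1)
qed

end
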